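(* Let $b=Mz^*+\epsilon$ with $M\in\mathbb{R}^{n\times d}$, $\epsilon\in\mathbb{R}^n$, and $z^*\in\{0,\pm1\}^d$ with $|\operatorname{supp}(z^* )|=\sigma$. Let $S:=\operatorname{supp}(z^* )$, $y^*:=-M^\top b/n$, $Y_{11}^*:=-(y_S^* )^\top z_S^*$, and assume $Y_{11}^*>0$. Let $H^0:=I_\sigma-z_S^*(z_S^* )^\top/\sigma$. Then (SILS'-SDP) recovers $z^*$ if there exists a constant $\delta>0$ such that the following conditions are satisfied: (E1) $\displaystyle\frac1{n\sigma}\|(M^\top\epsilon)_{S^c}\|_\infty\le\mu_3^*:=\frac1\sigma\Big\{\lambda_{\min}\Big(\frac1n(M^\top M)_{S,S}\Big)-\delta+\min_{i\in S}\Big(\frac1nM^\top\epsilon\Big)_i\big/z_i^*\Big\}$; (E2) there exists $\mu_2^*\in\big(-\infty,-\lambda_{\min}\big(\frac1n(M^\top M)_{S,S}\big)+\delta\big]$ such that the matrix $$\begin{aligned}\Theta:={}&\frac1n(M^\top M)_{S^c,S^c}-\frac{(M^\top\epsilon)_{S^c}(y_S^* )^\top}{\delta nY_{11}^*}H^0\Big(I_\sigma+\frac{y_S^*(z_S^* )^\top}{Y_{11}^*}\Big)\frac1n(M^\top M)_{S,S^c}-\frac1{Y_{11}^*}\Big(\frac1nM^\top\epsilon\Big)_{S^c}\Big(\frac1nM^\top\epsilon\Big)_{S^c}^\top\\ &-\frac1n(M^\top M)_{S^c,S}\Big(I_\sigma+\frac{z_S^*(y_S^* )^\top}{Y_{11}^*}\Big)H^0\frac{y_S^*(M^\top\epsilon)_{S^c}^\top}{\delta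 nY_{11}^*}-\frac1{\delta(nY_{11}^* )^2}(M^\top\epsilon)_{S^c}(y_S^* )^\top H^0y_S^*(M^\top\epsilon)_{S^c}^\top\\ &-\frac1{Y_{11}^*}\Big(\frac1nM^\top\epsilon\Big)_{S^c}\Big(\frac1n(M^\top M)_{S^c,S}z_S^*\Big)^\top-\frac1{Y_{11}^*}\Big(\frac1n(M^\top M)_{S^c,S}z_S^*\Big)\Big(\frac1nM^\top\epsilon\Big)_{S^c}^\top\\ &-\frac1{n^2}(M^\top M)_{S^c,S}\Big(\Big[I_\sigma+\frac1{Y_{11}^*}z_S^*(y_S^* )^\top\Big]\frac1\delta H^0\Big[I_\sigma+\frac1{Y_{11}^*}y_S^*(z_S^* )^\top\Big]+\frac{z_S^*(z_S^* )^\top}{Y_{11}^*}\Big)(M^\top M)_{S,S^c}+\mu_2^*I_{d-\sigma}\end{aligned}$$ can be written as a sum $\Theta=\Theta_1+\Theta_2$ with either $\Theta_1\succ0$ and $\|\Theta_2\|_\infty\le\mu_3^*$, or $\Theta_1\succeq0$ and $\|\Theta_2\|_\infty<\mu_3^*$.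
   Context: $n,d,\sigma$ are positive integers with $\sigma\le d$, and $A:=\begin{pmatrix}-b&M\end{pmatrix}\in\mathbb{R}^{n\times(1+d)}$. (SILS'-SDP): minimize $\frac1n\operatorname{tr}(A^\top AW)$ over symmetric positive semidefinite $W\in\mathbb{R}^{(1+d)\times(1+d)}$ subject to $W_{11}=1$, $\operatorname{tr}(W_x)=\sigma$, $1_d^\top|W_x|1_d\le\sigma^2$, $\operatorname{diag}(W_x)\le1_d$ (entrywise), where $W_x$ is $W$ with first row and column deleted, $|W_x|$ is the entrywise absolute value, and $1_d$ is the all-ones vector. "(SILS'-SDP) recovers $z^*$" means: $z^*\in\{0,\pm1\}^d$ and (SILS'-SDP) has a unique optimal solution, namely the rank-one matrix $W^*=\begin{pmatrix}1 \\ z^*\end{pmatrix}\begin{pmatrix}1 \\ z^*\end{pmatrix}^\top$. Notation: $\operatorname{supp}(x)=\{i:x_i\ne0\}$; $S^c=\{1,\dots,d\}\setminus S$; $v_I$ and $N_{I,J}$ denote the subvector and submatrix with the indicated indices; $\|\cdot\|_\infty$ is the largest absolute value of an entry of a vector or matrix ($0$ for an empty one); $\lambda_{\min}$ is the smallest eigenvalue; $\succ$, $\succeq$ denote positive (semi)definiteness of symmetric matrices. *)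

theory Defs
  imports
    "Jordan_Normal_Form.Spectral_Radius"
    "Jordan_Normal_Form.Determinant"
    "Jordan_Normal_Form.DL_Submatrix"
begin

(* Vectors and matrices are those of Jordan_Normal_Form, indexed from 0: the
   usual index set {1,...,d} becomes {0..<d}, and the entry W_11 becomes W $$ (0,0). *)

definition vec_supp :: "real vec \<Rightarrow> nat set" where
  "vec_supp x = {i. i < dim_vec x \<and> x $ i \<noteq> 0}"

(* The vector counterpart of submatrix: the entries with index in I, in increasing order. *)
definition subvec :: "'a vec \<Rightarrow> nat set \<Rightarrow> 'a vec" where
  "subvec v I = vec (card {i. i < dim_vec v \<and> i \<in> I}) (\<lambda>i. v $ pick I i)"

definition outer_prod :: "real vec \<Rightarrow> real vec \<Rightarrow> real mat" where
  "outer_prod u v = mat (dim_vec u) (dim_vec v) (\<lambda>(i, j). u $ i * v $ j)"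

definition mat_trace :: "real mat \<Rightarrow> real" where
  "mat_trace A = (\<Sum>i<dim_row A. A $$ (i, i))"

definition ones_vec :: "nat \<Rightarrow> real vec" where
  "ones_vec d = vec d (\<lambda>_. 1)"

(* Inserting 0 gives the empty vector or matrix norm 0 and changes nothing otherwise. *)
definition vec_norm_inf :: "real vec \<Rightarrow> real" where
  "vec_norm_inf v = Max (insert 0 {\<bar>v $ i\<bar> | i. i < dim_vec v})"

definition mat_norm_inf :: "real mat \<Rightarrow> real" where
  "mat_norm_inf A = Max (insert 0 (abs ` elements_mat A))"

definition pos_semidef :: "nat \<Rightarrow> real mat \<Rightarrow> bool" where
  "pos_semidef k A \<longleftrightarrow> A \<in> carrier_mat k k \<and> transpose_mat A = A \<and>
     (\<forall>v \<in> carrier_vec k. 0 \<le> v \<bullet> (A *\<^sub>v v))"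

definition pos_def :: "nat \<Rightarrow> real mat \<Rightarrow> bool" where
  "pos_def k A \<longleftrightarrow> A \<in> carrier_mat k k \<and> transpose_mat A = A \<and>
     (\<forall>v \<in> carrier_vec k. v \<noteq> 0\<^sub>v k \<longrightarrow> 0 < v \<bullet> (A *\<^sub>v v))"

(* Only used for symmetric real matrices of positive size, whose real spectrum is
   finite, nonempty and consists of all eigenvalues. *)
definition lambda_min :: "real mat \<Rightarrow> real" where
  "lambda_min A = Min (spectrum A)"

definition sils_A :: "nat \<Rightarrow> real mat \<Rightarrow> real vec \<Rightarrow> real mat" where
  "sils_A n M b = mat_of_cols n (- b # cols M)"

definition sils_feasible :: "nat \<Rightarrow> nat \<Rightarrow> real mat \<Rightarrow> bool" where
  "sils_feasible d \<sigma> W \<longleftrightarrow>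
     (let Wx = mat_delete W 0 0 in
       pos_semidef (1 + d) W \<and>
       W $$ (0, 0) = 1 \<and>
       mat_trace Wx = real \<sigma> \<and>
       ones_vec d \<bullet> (map_mat abs Wx *\<^sub>v ones_vec d) \<le> (real \<sigma>)\<^sup>2 \<and>
       (\<forall>i<d. Wx $$ (i, i) \<le> 1))"

definition sils_objective :: "nat \<Rightarrow> real mat \<Rightarrow> real vec \<Rightarrow> real mat \<Rightarrow> real" where
  "sils_objective n M b W =
     1 / real n * mat_trace (transpose_mat (sils_A n M b) * sils_A n M b * W)"

definition sils_optimal ::
  "nat \<Rightarrow> nat \<Rightarrow> nat \<Rightarrow> real mat \<Rightarrow> real vec \<Rightarrow> real mat \<Rightarrow> bool" where
  "sils_optimal n d \<sigma> M b W \<longleftrightarrow> sils_feasible d \<sigma> W \<and>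
     (\<forall>W'. sils_feasible d \<sigma> W' \<longrightarrow> sils_objective n M b W \<le> sils_objective n M b W')"

definition sign_vecs :: "nat \<Rightarrow> real vec set" where
  "sign_vecs d = {z \<in> carrier_vec d. \<forall>i<d. z $ i \<in> {0, 1, -1}}"

definition sils_recovers ::
  "nat \<Rightarrow> nat \<Rightarrow> nat \<Rightarrow> real mat \<Rightarrow> real vec \<Rightarrow> real vec \<Rightarrow> bool" where
  "sils_recovers n d \<sigma> M b z \<longleftrightarrow> z \<in> sign_vecs d \<and>
     {W. sils_optimal n d \<sigma> M b W} = {outer_prod (vCons 1 z) (vCons 1 z)}"

definition H0_mat :: "nat \<Rightarrow> real vec \<Rightarrow> real mat" where
  "H0_mat \<sigma> zS = 1\<^sub>m \<sigma> - (1 / real \<sigma>) \<cdot>\<^sub>m outer_prod zS zS"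

definition mu3_star ::
  "nat \<Rightarrow> nat \<Rightarrow> nat set \<Rightarrow> real mat \<Rightarrow> real vec \<Rightarrow> real vec \<Rightarrow> real \<Rightarrow> real" where
  "mu3_star n \<sigma> S M \<epsilon> z \<delta> = 1 / real \<sigma> *
     (lambda_min ((1 / real n) \<cdot>\<^sub>m submatrix (transpose_mat M * M) S S) - \<delta>
      + Min ((\<lambda>i. ((1 / real n) \<cdot>\<^sub>v (transpose_mat M *\<^sub>v \<epsilon>)) $ i / z $ i) ` S))"

(* The Schur-complement type matrix on the complement of S; yS, zS and Y11 stand for
   the restrictions of y* = -M^T b / n and of z* to S, and for -(yS)^T zS. *)
definition Theta_mat ::
  "nat \<Rightarrow> nat \<Rightarrow> nat \<Rightarrow> nat set \<Rightarrow> real mat \<Rightarrow> real vec \<Rightarrow> real vec \<Rightarrow> real vec \<Rightarrow> real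
    \<Rightarrow> real \<Rightarrow> real \<Rightarrow> real mat" where
  "Theta_mat n d \<sigma> S M \<epsilon> yS zS Y11 \<delta> \<mu>2 =
     (let N = real n;
          Sc = {0..<d} - S;
          MM = transpose_mat M * M;
          e = subvec (transpose_mat M *\<^sub>v \<epsilon>) Sc;
          I = 1\<^sub>m \<sigma>;
          H0 = H0_mat \<sigma> zS
      in
        (1 / N) \<cdot>\<^sub>m submatrix MM Sc Sc
        - (1 / (\<delta> * N * Y11)) \<cdot>\<^sub>m outer_prod e yS * H0 * (I + (1 / Y11) \<cdot>\<^sub>m outer_prod yS zS)
            * ((1 / N) \<cdot>\<^sub>m submatrix MM S Sc)
        - (1 / Y11) \<cdot>\<^sub>m outer_prod ((1 / N) \<cdot>\<^sub>v e) ((1 / N) \<cdot>\<^sub>v e)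
        - (1 / N) \<cdot>\<^sub>m submatrix MM Sc S * (I + (1 / Y11) \<cdot>\<^sub>m outer_prod zS yS) * H0
            * ((1 / (\<delta> * N * Y11)) \<cdot>\<^sub>m outer_prod yS e)
        - (1 / (\<delta> * (N * Y11)\<^sup>2)) \<cdot>\<^sub>m (outer_prod e yS * H0 * outer_prod yS e)
        - (1 / Y11) \<cdot>\<^sub>m outer_prod ((1 / N) \<cdot>\<^sub>v e) ((1 / N) \<cdot>\<^sub>m submatrix MM Sc S *\<^sub>v zS)
        - (1 / Y11) \<cdot>\<^sub>m outer_prod ((1 / N) \<cdot>\<^sub>m submatrix MM Sc S *\<^sub>v zS) ((1 / N) \<cdot>\<^sub>v e)
        - (1 / N\<^sup>2) \<cdot>\<^sub>m (submatrix MM Sc S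
            * ((I + (1 / Y11) \<cdot>\<^sub>m outer_prod zS yS) * ((1 / \<delta>) \<cdot>\<^sub>m H0)
                 * (I + (1 / Y11) \<cdot>\<^sub>m outer_prod yS zS)
               + (1 / Y11) \<cdot>\<^sub>m outer_prod zS zS)
            * submatrix MM S Sc)
        + \<mu>2 \<cdot>\<^sub>m 1\<^sub>m (d - \<sigma>))"

end

theory Submission
  imports Defs
begin

text \<open>
  The proof builds a dual certificate. Let \<open>w = (1, z)\<close>, \<open>G = M\<^sup>T M / n\<close>, \<open>e = M\<^sup>T \<epsilon> / n\<close>. Take the
  multipliers \<open>\<mu>2\<close> for the trace, \<open>\<mu>3\<close> for the \<open>1\<close>-norm and \<open>p \<ge> 0\<close> for the diagonal constraint,
  together with a matrix \<open>R\<close> with entries in \<open>[-\<mu>3, \<mu>3]\<close> that equals \<open>\<mu>3 z z\<^sup>T\<close> on \<open>S \<times> S\<close>,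
  \<open>e z\<^sup>T / \<sigma>\<close> on \<open>S\<^sup>c \<times> S\<close> (admissible by (E1)) and \<open>-\<Theta>2\<close> on \<open>S\<^sup>c \<times> S\<^sup>c\<close>. They make the dual slack
  matrix \<open>Y\<close> annihilate \<open>w\<close>, and the objective gap of a feasible \<open>W\<close> is \<open>tr (Y W)\<close> plus nonnegative
  complementary slackness terms. Eliminating the first coordinate and the block of \<open>S\<close>, on which \<open>Y\<close>
  dominates \<open>\<delta> H\<^sup>0\<close>, leaves a lower bound of the form of \<open>Y\<close> by that of \<open>\<Theta> - \<Theta>2 = \<Theta>1\<close>. Writing
  \<open>W\<close> as a sum of squares \<open>L\<^sub>k L\<^sub>k\<^sup>T\<close>, a vanishing gap forces each \<open>L\<^sub>k\<close> to vanish on \<open>S\<^sup>c\<close> (by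
  \<open>\<Theta>1 \<succ> 0\<close>, or by complementary slackness in the \<open>1\<close>-norm if \<open>\<Theta>2\<close> has slack) and then to be a
  multiple of \<open>w\<close>.
\<close>

subsection \<open>Positive semidefinite forms and the smallest eigenvalue\<close>

text \<open>Symmetric elimination, by induction on the index set: the pivot \<open>a\<close>
  contributes one square and the Schur complement \<open>V\<close> is again positive semidefinite.
  This splits a feasible \<open>W\<close> into rank-one terms, so that a trace against
  \<open>W\<close> becomes a sum of values of a quadratic form.\<close>

lemma psd_gram:
  fixes W :: "'a \<Rightarrow> 'a \<Rightarrow> real"
  assumes "finite I"
    and "\<And>i j. i \<in> I \<Longrightarrow> j \<in> I \<Longrightarrow> W i j = W j i"
    and "\<And>v. 0 \<le> (\<Sum>i\<in>I. \<Sum>j\<in>I. v i * W i j * v j)"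
  shows "\<exists>L. \<forall>i\<in>I. \<forall>j\<in>I. W i j = (\<Sum>k\<in>I. L k i * L k j)"
  using assms
proof (induction I arbitrary: W rule: finite_induct)
  case empty
  then show ?case by simp
next
  case (insert a I)
  note sym = insert.prems(1) and psd = insert.prems(2)
  have quad: "0 \<le> W a a * t\<^sup>2 + 2 * t * (\<Sum>i\<in>I. W a i * v i)
      + (\<Sum>i\<in>I. \<Sum>j\<in>I. v i * W i j * v j)" for t and v :: "'a \<Rightarrow> real"
  proof -
    have ne: "i \<noteq> a" if "i \<in> I" for i using that insert.hyps by auto
    define u where "u = v(a := t)"
    have "0 \<le> (\<Sum>i\<in>insert a I. \<Sum>j\<in>insert a I. u i * W i j * u j)" by (rule psd)
    also have "\<dots> = W a a * t\<^sup>2 + (\<Sum>i\<in>I. t * (W a i * v i)) + (\<Sum>i\<in>I. t * (W i a * v i))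
        + (\<Sum>i\<in>I. \<Sum>j\<in>I. v i * W i j * v j)"
      using insert.hyps ne
      by (simp add: u_def sum.distrib power2_eq_square algebra_simps cong: sum.cong)
    also have "(\<Sum>i\<in>I. t * (W i a * v i)) = (\<Sum>i\<in>I. t * (W a i * v i))"
      by (rule sum.cong) (use sym in auto)
    finally show ?thesis by (simp add: sum_distrib_left algebra_simps)
  qed
  have w0: "0 \<le> W a a" using quad[of 1 "\<lambda>_. 0"] by simp
  \<comment> \<open>With a zero pivot the form is affine in \<open>t\<close>, so a nonzero slope
    would make it negative somewhere. The \<open>t\<close> used below, with the indicator of
    \<open>i\<close> as \<open>v\<close>, gives the value -1.\<close>
  have row0: "W a i = 0" if "W a a = 0" and i: "i \<in> I" for i
  proof (rule ccontr)
    assume nz: "W a i \<noteq> 0"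
    have 1: "(\<Sum>k\<in>I. W a k * (if k = i then 1 else 0)) = W a i"
      using i insert.hyps by (simp add: if_distrib[of "\<lambda>x. _ * x"] cong: if_cong)
    have 2: "(\<Sum>k\<in>I. \<Sum>j\<in>I. (if k = i then 1 else 0) * W k j * (if j = i then 1 else 0)) = W i i"
      using i insert.hyps by (simp add: if_distrib[of "\<lambda>x. x * _"] if_distrib[of "\<lambda>x. _ * x"] cong: if_cong)
    show False
      using quad[of "- (W i i + 1) / (2 * W a i)" "\<lambda>k. if k = i then 1 else 0"] nz that(1)
      by (simp only: 1 2) (simp add: field_simps)
  qed
  \<comment> \<open>This is the Schur complement of the pivot. Since division by 0 gives 0, it is
    just \<open>W\<close> when the pivot vanishes, and no separate construction is needed.\<close>
  define V where "V i j = W i j - W a i * W a j / W a a" for i j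
  have "\<exists>L. \<forall>i\<in>I. \<forall>j\<in>I. V i j = (\<Sum>k\<in>I. L k i * L k j)"
  proof (rule insert.IH)
    show "V i j = V j i" if "i \<in> I" "j \<in> I" for i j
      using sym that by (simp add: V_def)
    show "0 \<le> (\<Sum>i\<in>I. \<Sum>j\<in>I. v i * V i j * v j)" for v
    proof -
      let ?B = "\<Sum>i\<in>I. W a i * v i"
      let ?C = "\<Sum>i\<in>I. \<Sum>j\<in>I. v i * W i j * v j"
      have "?B\<^sup>2 / W a a = (\<Sum>i\<in>I. \<Sum>j\<in>I. v i * (W a i * W a j / W a a) * v j)"
        by (simp add: power2_eq_square sum_product sum_divide_distrib mult_ac)
      then have "(\<Sum>i\<in>I. \<Sum>j\<in>I. v i * V i j * v j) = ?C - ?B\<^sup>2 / W a a"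
        by (simp add: V_def algebra_simps sum_subtractf)
      also have "0 \<le> \<dots>"
      proof (cases "W a a = 0")
        case True
        then show ?thesis using quad[of 0 v] by simp
      next
        case False
        \<comment> \<open>This \<open>t\<close> minimizes the quadratic polynomial, whose minimum is
          the value of the Schur complement at \<open>v\<close>.\<close>
        then show ?thesis using quad[of "- ?B / W a a" v]
          by (simp add: field_simps power2_eq_square)
      qed
      finally show ?thesis .
    qed
  qed
  then obtain L where L: "\<And>i j. i \<in> I \<Longrightarrow> j \<in> I \<Longrightarrow> V i j = (\<Sum>k\<in>I. L k i * L k j)" by blast
  \<comment> \<open>The new vector is the pivot row scaled by the root of the pivot; the old ones
    are extended by 0 at \<open>a\<close>. With a zero pivot the new vector is 0, which agrees with
    \<open>row0\<close>.\<close>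
  define L' where "L' k i = (if k = a then W a i / sqrt (W a a) else if i = a then 0 else L k i)" for k i
  have ne: "i \<noteq> a" if "i \<in> I" for i using that insert.hyps by auto
  have sym_a: "W i a = W a i" if "i \<in> I" for i using sym that by simp
  have eq: "(\<Sum>k\<in>insert a I. L' k i * L' k j) = W a i * W a j / W a a
      + (if i = a \<or> j = a then 0 else \<Sum>k\<in>I. L k i * L k j)" for i j
    using insert.hyps ne by (auto simp: L'_def w0 intro!: sum.cong)
  have "W i j = (\<Sum>k\<in>insert a I. L' k i * L' k j)" if "i \<in> insert a I" "j \<in> insert a I" for i j
    unfolding eq using that L[of i j] ne row0 sym_a by (cases "W a a = 0") (auto simp: V_def)
  then show ?case by blast
qed

section \<open>Quadratic forms as double sums, and elementary bounds\<close>

lemma quad_form_sum: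
  fixes A :: "real mat"
  assumes "A \<in> carrier_mat k l" "v \<in> carrier_vec k" "w \<in> carrier_vec l"
  shows "v \<bullet> (A *\<^sub>v w) = (\<Sum>i<k. \<Sum>j<l. v $ i * A $$ (i, j) * w $ j)"
  using assms by (simp add: scalar_prod_def atLeast0LessThan sum_distrib_left mult.assoc)

lemma scalar_prod_self_sum:
  fixes v :: "real vec"
  assumes "v \<in> carrier_vec k"
  shows "v \<bullet> v = (\<Sum>i<k. (v $ i)\<^sup>2)"
  using assms by (simp add: scalar_prod_def atLeast0LessThan power2_eq_square)

lemma scalar_prod_self_nonneg: "0 \<le> v \<bullet> (v :: real vec)"
  by (simp add: scalar_prod_def sum_nonneg)

lemma scalar_prod_self_pos:
  fixes v :: "real vec"
  assumes "v \<in> carrier_vec k" "v \<noteq> 0\<^sub>v k"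
  shows "0 < v \<bullet> v"
proof -
  obtain i where "i < k" "v $ i \<noteq> 0" using assms by (metis carrier_vecD eq_vecI index_zero_vec)
  then show ?thesis unfolding scalar_prod_self_sum[OF assms(1)]
    by (intro sum_pos2[of _ i]) auto
qed

text \<open>A crude bound suffices: it is only used to make the Rayleigh quotient bounded below and
  to have some finite constant for the form of an inverse.\<close>

lemma quad_form_bound:
  fixes A :: "real mat"
  assumes "A \<in> carrier_mat k k" "v \<in> carrier_vec k"
  shows "\<bar>v \<bullet> (A *\<^sub>v v)\<bar> \<le> (\<Sum>i<k. \<Sum>j<k. \<bar>A $$ (i, j)\<bar>) * (v \<bullet> v)"
proof -
  have sq: "(v $ i)\<^sup>2 \<le> v \<bullet> v" if "i < k" for i
    unfolding scalar_prod_self_sum[OF assms(2)] using that by (intro member_le_sum) auto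
  have prod_le: "\<bar>v $ i * v $ j\<bar> \<le> v \<bullet> v" if "i < k" "j < k" for i j
  proof -
    have "2 * \<bar>v $ i * v $ j\<bar> \<le> (v $ i)\<^sup>2 + (v $ j)\<^sup>2"
      using sum_squares_bound[of "\<bar>v $ i\<bar>" "\<bar>v $ j\<bar>"] by (simp add: abs_mult)
    then show ?thesis using sq[OF that(1)] sq[OF that(2)] by linarith
  qed
  have "\<bar>v \<bullet> (A *\<^sub>v v)\<bar> \<le> (\<Sum>i<k. \<Sum>j<k. \<bar>v $ i * A $$ (i, j) * v $ j\<bar>)"
    unfolding quad_form_sum[OF assms(1) assms(2) assms(2)]
    by (rule order_trans[OF sum_abs]) (rule sum_mono, rule sum_abs)
  also have "\<dots> \<le> (\<Sum>i<k. \<Sum>j<k. \<bar>A $$ (i, j)\<bar> * (v \<bullet> v))"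
  proof (intro sum_mono)
    fix i j assume "i \<in> {..<k}" "j \<in> {..<k}"
    then have "\<bar>A $$ (i, j)\<bar> * \<bar>v $ i * v $ j\<bar> \<le> \<bar>A $$ (i, j)\<bar> * (v \<bullet> v)"
      by (intro mult_left_mono prod_le) auto
    then show "\<bar>v $ i * A $$ (i, j) * v $ j\<bar> \<le> \<bar>A $$ (i, j)\<bar> * (v \<bullet> v)"
      by (simp add: abs_mult mult_ac)
  qed
  finally show ?thesis by (simp add: sum_distrib_right)
qed

lemma symmetric_form_commute:
  fixes A :: "real mat"
  assumes "A \<in> carrier_mat k k" "transpose_mat A = A" "v \<in> carrier_vec k" "w \<in> carrier_vec k"
  shows "v \<bullet> (A *\<^sub>v w) = w \<bullet> (A *\<^sub>v v)"
proof -
  have "A $$ (i, j) = A $$ (j, i)" if "i < k" "j < k" for i j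
    using assms(1) that arg_cong[OF assms(2), of "\<lambda>B. B $$ (i, j)"] by simp
  then show ?thesis
    unfolding quad_form_sum[OF assms(1,3,4)] quad_form_sum[OF assms(1,4,3)]
    by (subst sum.swap) (auto intro!: sum.cong)
qed

text \<open>The form at \<open>v + t w\<close> is a nonnegative quadratic polynomial in
  \<open>t\<close>. Evaluate it at its minimizer; if the leading coefficient is 0, nonnegativity
  kills the linear one.\<close>

lemma pos_semidef_Cauchy_Schwarz:
  assumes "pos_semidef k A" and v: "v \<in> carrier_vec k" and w: "w \<in> carrier_vec k"
  shows "(v \<bullet> (A *\<^sub>v w))\<^sup>2 \<le> (v \<bullet> (A *\<^sub>v v)) * (w \<bullet> (A *\<^sub>v w))"
proof -
  have A: "A \<in> carrier_mat k k" and sym: "transpose_mat A = A"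
    and psd: "\<And>x. x \<in> carrier_vec k \<Longrightarrow> 0 \<le> x \<bullet> (A *\<^sub>v x)"
    using assms(1) by (auto simp: pos_semidef_def)
  let ?a = "v \<bullet> (A *\<^sub>v v)" and ?b = "v \<bullet> (A *\<^sub>v w)" and ?c = "w \<bullet> (A *\<^sub>v w)"
  have quad: "0 \<le> ?a + 2 * t * ?b + ?c * t\<^sup>2" for t
  proof -
    have "0 \<le> (v + t \<cdot>\<^sub>v w) \<bullet> (A *\<^sub>v (v + t \<cdot>\<^sub>v w))"
      by (rule psd) (use v w in auto)
    also have "\<dots> = ?a + t * ?b + t * (w \<bullet> (A *\<^sub>v v)) + t * (t * ?c)"
      using A v w
      by (simp add: mult_add_distrib_mat_vec[of _ k k] mult_mat_vec[of _ k k]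
          add_scalar_prod_distrib[of _ k] scalar_prod_add_distrib[of _ k] algebra_simps)
    finally show ?thesis
      using symmetric_form_commute[OF A sym v w] by (simp add: power2_eq_square algebra_simps)
  qed
  have "0 \<le> ?c" by (rule psd[OF w])
  show ?thesis
  proof (cases "?c = 0")
    case True
    have "?b = 0"
    proof (rule ccontr)
      assume "?b \<noteq> 0"
      then show False using quad[of "- (?a + 1) / (2 * ?b)"] True by (simp add: field_simps)
    qed
    then show ?thesis using True by simp
  next
    case False
    with \<open>0 \<le> ?c\<close> have "0 < ?c" by simp
    then show ?thesis using quad[of "- ?b / ?c"]
      by (simp add: field_simps power2_eq_square)
  qed
qed

lemma smult_mat_mult_vec:
  fixes A :: "real mat"
  assumes "A \<in> carrier_mat k l" "v \<in> carrier_vec l"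
  shows "(c \<cdot>\<^sub>m A) *\<^sub>v v = c \<cdot>\<^sub>v (A *\<^sub>v v)"
  using assms by (intro eq_vecI) auto

text \<open>The infimum \<open>m\<close> of the Rayleigh quotient is an eigenvalue: otherwise \<open>A - m I\<close> would have
  an inverse \<open>K\<close>, and Cauchy--Schwarz for \<open>v\<close> and \<open>K v\<close> would bound its form away from \<open>0\<close>.\<close>

lemma lambda_min_le_form:
  fixes A :: "real mat"
  assumes A: "A \<in> carrier_mat k k" and sym: "transpose_mat A = A" and v: "v \<in> carrier_vec k"
  shows "lambda_min A * (v \<bullet> v) \<le> v \<bullet> (A *\<^sub>v v)"
proof (cases "v = 0\<^sub>v k")
  case True
  then show ?thesis using A by simp
next
  case vnz: False
  define U where "U = {x \<in> carrier_vec k. x \<bullet> x = (1::real)}"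
  define Q where "Q x = x \<bullet> (A *\<^sub>v x)" for x
  define m where "m = Inf (Q ` U)"
  have scale: "\<exists>x\<in>U. Q w = Q x * (w \<bullet> w)" if w: "w \<in> carrier_vec k" "w \<noteq> 0\<^sub>v k" for w
  proof -
    have pos: "0 < w \<bullet> w" using w by (rule scalar_prod_self_pos)
    let ?x = "(1 / sqrt (w \<bullet> w)) \<cdot>\<^sub>v w"
    have "?x \<in> U" using w pos by (simp add: U_def)
    moreover have "Q w = Q ?x * (w \<bullet> w)"
      using w A pos by (simp add: Q_def mult_mat_vec[of _ k k] field_simps)
    ultimately show ?thesis by blast
  qed
  have bdd: "bdd_below (Q ` U)"
  proof (rule bdd_belowI2)
    fix x assume "x \<in> U"
    then show "- (\<Sum>i<k. \<Sum>j<k. \<bar>A $$ (i, j)\<bar>) \<le> Q x"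
      using quad_form_bound[OF A, of x] by (simp add: U_def Q_def)
  qed
  have m_le: "m * (w \<bullet> w) \<le> Q w" if "w \<in> carrier_vec k" for w
  proof (cases "w = 0\<^sub>v k")
    case True
    then show ?thesis using A by (simp add: Q_def)
  next
    case False
    with scale that obtain x where "x \<in> U" "Q w = Q x * (w \<bullet> w)" by blast
    moreover have "m \<le> Q x" unfolding m_def using \<open>x \<in> U\<close> bdd by (simp add: cINF_lower)
    ultimately show ?thesis by (simp add: mult_right_mono scalar_prod_self_nonneg)
  qed
  have "eigenvalue A m"
  proof (rule ccontr)
    assume "\<not> eigenvalue A m"
    define B where "B = char_matrix A m"
    have B: "B \<in> carrier_mat k k" using A by (simp add: B_def)
    have Bform: "x \<bullet> (B *\<^sub>v w) = x \<bullet> (A *\<^sub>v w) - m * (x \<bullet> w)"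
      if "x \<in> carrier_vec k" "w \<in> carrier_vec k" for x w
      using that A
      by (simp add: B_def char_matrix_def add_mult_distrib_mat_vec[of _ k k]
          smult_mat_mult_vec[of _ k k] scalar_prod_add_distrib[of _ k])
    have "transpose_mat (- m \<cdot>\<^sub>m 1\<^sub>m k) = - m \<cdot>\<^sub>m 1\<^sub>m k" by (intro eq_matI) auto
    then have Bsym: "transpose_mat B = B"
      using A sym by (simp add: B_def char_matrix_def transpose_add[of _ k k])
    have psd: "pos_semidef k B"
      using B Bsym m_le by (simp add: pos_semidef_def Bform Q_def)
    have "det B \<noteq> 0" using \<open>\<not> eigenvalue A m\<close> eigenvalue_det[OF A] by (simp add: B_def)
    from det_non_zero_imp_unit[OF B this, of undefined]
    obtain K where K: "K \<in> carrier_mat k k" and BK: "B * K = 1\<^sub>m k"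
      unfolding Units_def ring_mat_def by auto
    \<comment> \<open>The summand 1 makes \<open>c\<close> strictly positive, so that
      \<open>1 / c\<close> is a genuine gap.\<close>
    define c where "c = (\<Sum>i<k. \<Sum>j<k. \<bar>K $$ (i, j)\<bar>) + 1"
    have c: "0 < c" unfolding c_def by (intro add_nonneg_pos sum_nonneg) auto
    have gap: "m + 1 / c \<le> Q x" if "x \<in> U" for x
    proof -
      have x: "x \<in> carrier_vec k" "x \<bullet> x = 1" using that by (auto simp: U_def)
      have Kx: "K *\<^sub>v x \<in> carrier_vec k" using K x by simp
      have BKx: "B *\<^sub>v (K *\<^sub>v x) = x"
        using assoc_mult_mat_vec[OF B K x(1)] BK x by simp
      \<comment> \<open>Because \<open>B\<close> maps \<open>K x\<close> to \<open>x\<close>, the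
        mixed term of Cauchy-Schwarz is \<open>x \<bullet> x = 1\<close>, and the form of
        \<open>B\<close> at \<open>K x\<close> is the form of \<open>K\<close> at
        \<open>x\<close>.\<close>
      have "1 \<le> (x \<bullet> (B *\<^sub>v x)) * ((K *\<^sub>v x) \<bullet> x)"
        using pos_semidef_Cauchy_Schwarz[OF psd x(1) Kx] BKx x by simp
      also have "\<dots> \<le> (x \<bullet> (B *\<^sub>v x)) * c"
      proof (rule mult_left_mono)
        have "(K *\<^sub>v x) \<bullet> x = x \<bullet> (K *\<^sub>v x)" using comm_scalar_prod[OF Kx x(1)] .
        then show "(K *\<^sub>v x) \<bullet> x \<le> c"
          using quad_form_bound[OF K x(1)] x by (simp add: c_def)
        show "0 \<le> x \<bullet> (B *\<^sub>v x)" using psd x by (simp add: pos_semidef_def)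
      qed
      finally show ?thesis using c x by (simp add: Bform Q_def field_simps)
    qed
    have "U \<noteq> {}" using scale[OF v vnz] by blast
    then have "m + 1 / c \<le> m" unfolding m_def[symmetric]
      using cINF_greatest[of U "m + 1 / c" Q] gap by (simp add: m_def)
    then show False using c by simp
  qed
  then have "lambda_min A \<le> m"
    using card_finite_spectrum(1)[OF A] by (simp add: lambda_min_def spectrum_def)
  then have "lambda_min A * (v \<bullet> v) \<le> m * (v \<bullet> v)"
    by (rule mult_right_mono) (rule scalar_prod_self_nonneg)
  then show ?thesis using m_le[OF v] by (simp add: Q_def)
qed

subsection \<open>The quadratic form of \<open>\<Theta>\<close>\<close>

lemma outer_prod_carrier [simp]:
  "u \<in> carrier_vec k \<Longrightarrow> v \<in> carrier_vec l \<Longrightarrow> outer_prod u v \<in> carrier_mat k l"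
  by (simp add: outer_prod_def)

lemma outer_prod_mult_vec:
  assumes "w \<in> carrier_vec (dim_vec v)"
  shows "outer_prod u v *\<^sub>v w = (v \<bullet> w) \<cdot>\<^sub>v u"
  using assms
  by (intro eq_vecI) (auto simp: outer_prod_def scalar_prod_def sum_distrib_left mult_ac intro!: sum.cong)

lemma H0_mat_carrier [simp]: "z \<in> carrier_vec \<sigma> \<Longrightarrow> H0_mat \<sigma> z \<in> carrier_mat \<sigma> \<sigma>"
  by (simp add: H0_mat_def minus_carrier_mat)

lemma H0_mat_form:
  assumes "z \<in> carrier_vec \<sigma>" "v \<in> carrier_vec \<sigma>" "w \<in> carrier_vec \<sigma>"
  shows "v \<bullet> (H0_mat \<sigma> z *\<^sub>v w) = v \<bullet> w - (z \<bullet> v) * (z \<bullet> w) / real \<sigma>"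
  using assms
  by (simp add: H0_mat_def minus_mult_distrib_mat_vec[of _ \<sigma> \<sigma>] smult_mat_mult_vec[of _ \<sigma> \<sigma>]
      outer_prod_mult_vec scalar_prod_minus_distrib[of _ \<sigma>] comm_scalar_prod[of v \<sigma> z])

lemma scalar_prod_transpose_mult:
  fixes B :: "real mat"
  assumes "B \<in> carrier_mat k l" "v \<in> carrier_vec k" "c \<in> carrier_vec l"
  shows "c \<bullet> (transpose_mat B *\<^sub>v v) = v \<bullet> (B *\<^sub>v c)"
  using assms quad_form_sum[of "transpose_mat B" l k c v] quad_form_sum[of B k l v c]
  by (simp add: mult_ac sum.swap[of _ "{..<l}"])

lemma submatrix_carrier:
  assumes "A \<in> carrier_mat p q" "I \<subseteq> {0..<p}" "J \<subseteq> {0..<q}"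
  shows "submatrix A I J \<in> carrier_mat (card I) (card J)"
proof -
  have "{i. i < p \<and> i \<in> I} = I" "{i. i < q \<and> i \<in> J} = J" using assms by auto
  then show ?thesis using assms by (intro carrier_matI) (simp_all add: dim_submatrix)
qed

lemma transpose_submatrix: "transpose_mat (submatrix A I J) = submatrix (transpose_mat A) J I"
proof (rule eq_matI)
  fix i j assume "i < dim_row (submatrix (transpose_mat A) J I)" "j < dim_col (submatrix (transpose_mat A) J I)"
  then have "i < card {i. i < dim_col A \<and> i \<in> J}" "j < card {i. i < dim_row A \<and> i \<in> I}"
    by (simp_all add: dim_submatrix)
  then show "transpose_mat (submatrix A I J) $$ (i, j) = submatrix (transpose_mat A) J I $$ (i, j)"
    by (simp add: dim_submatrix submatrix_index pick_le)
qed (simp_all add: dim_submatrix)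

lemma subvec_carrier:
  assumes "v \<in> carrier_vec p" "I \<subseteq> {0..<p}"
  shows "subvec v I \<in> carrier_vec (card I)"
proof -
  have "{i. i < p \<and> i \<in> I} = I" using assms by auto
  then show ?thesis using assms by (simp add: subvec_def)
qed

text \<open>The nine summands of \<Theta> regroup into a twofold Schur complement. Removing the
  corner \<open>Y11\<close> costs the square of \<open>zS \<bullet> g + u\<close>; removing the
  block of \<open>S\<close>, with \<delta> times \<open>H0_mat\<close> in its place, costs the form
  of \<open>H0_mat\<close> at the vector \<open>h\<close> left in the border.\<close>

lemma Theta_mat_form:
  fixes M :: "real mat"
  assumes M: "M \<in> carrier_mat n d" and eps: "\<epsilon> \<in> carrier_vec n" and S: "S \<subseteq> {0..<d}" "card S = \<sigma>"
    and yS: "yS \<in> carrier_vec \<sigma>" and zS: "zS \<in> carrier_vec \<sigma>"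
    and c: "c \<in> carrier_vec (d - \<sigma>)"
    and Sc_def: "Sc = {0..<d} - S"
    and g_def: "g = (1 / real n) \<cdot>\<^sub>v (submatrix (transpose_mat M * M) S Sc *\<^sub>v c)"
    and u_def: "u = subvec (transpose_mat M *\<^sub>v \<epsilon>) Sc \<bullet> c / real n"
    and h_def: "h = g + ((zS \<bullet> g + u) / Y11) \<cdot>\<^sub>v yS"
  shows "c \<bullet> (Theta_mat n d \<sigma> S M \<epsilon> yS zS Y11 \<delta> \<mu>2 *\<^sub>v c)
    = c \<bullet> (submatrix (transpose_mat M * M) Sc Sc *\<^sub>v c) / real n + \<mu>2 * (c \<bullet> c)
      - (zS \<bullet> g + u)\<^sup>2 / Y11 - (h \<bullet> (H0_mat \<sigma> zS *\<^sub>v h)) / \<delta>"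
proof -
  define k where "k = d - \<sigma>"
  have fS: "finite S" using S finite_subset by auto
  have cSc: "card Sc = k" unfolding Sc_def k_def using S fS by (simp add: card_Diff_subset)
  have Sc: "Sc \<subseteq> {0..<d}" by (auto simp: Sc_def)
  have MM: "transpose_mat M * M \<in> carrier_mat d d" using M by simp
  have MMsym: "transpose_mat (transpose_mat M * M) = transpose_mat M * M"
    using M by (simp add: transpose_mult[of _ d n _ d])
  define B where "B = submatrix (transpose_mat M * M) S Sc"
  define D where "D = submatrix (transpose_mat M * M) Sc Sc"
  define E where "E = subvec (transpose_mat M *\<^sub>v \<epsilon>) Sc"
  define H where "H = H0_mat \<sigma> zS"
  define r where "r = 1 / real n"
  have B: "B \<in> carrier_mat \<sigma> k" unfolding B_def using submatrix_carrier[OF MM S(1) Sc] S(2) cSc by simp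
  have D: "D \<in> carrier_mat k k" unfolding D_def using submatrix_carrier[OF MM Sc Sc] cSc by simp
  have E: "E \<in> carrier_vec k" unfolding E_def using subvec_carrier[of _ d, OF _ Sc] M eps cSc
    by (metis carrier_vecI dim_mult_mat_vec index_transpose_mat(2) carrier_matD(2))
  have H: "H \<in> carrier_mat \<sigma> \<sigma>" unfolding H_def using zS by simp
  have BT: "submatrix (transpose_mat M * M) Sc S = transpose_mat B"
    unfolding B_def transpose_submatrix MMsym ..
  have BT': "transpose_mat B \<in> carrier_mat k \<sigma>" using B by simp
  have c': "c \<in> carrier_vec k" using c by (simp add: k_def)
  define p where "p = B *\<^sub>v c"
  have p: "p \<in> carrier_vec \<sigma>" unfolding p_def using B c' by simp
  have Bt: "c \<bullet> (transpose_mat B *\<^sub>v v) = v \<bullet> p" if "v \<in> carrier_vec \<sigma>" for v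
    unfolding p_def using scalar_prod_transpose_mult[OF B that c'] .
  have Hform: "v \<bullet> (H *\<^sub>v w) = v \<bullet> w - (zS \<bullet> v) * (zS \<bullet> w) / real \<sigma>"
    if "v \<in> carrier_vec \<sigma>" "w \<in> carrier_vec \<sigma>" for v w
    unfolding H_def using zS that by (rule H0_mat_form)
  note car = B BT' D E H c' p yS zS
  have Hc: "H *\<^sub>v w \<in> carrier_vec \<sigma>" if "w \<in> carrier_vec \<sigma>" for w using H that by simp
  have Hsym: "v \<bullet> (H *\<^sub>v w) = w \<bullet> (H *\<^sub>v v)"
    if "v \<in> carrier_vec \<sigma>" "w \<in> carrier_vec \<sigma>" for v w
    using that by (simp add: Hform comm_scalar_prod[of v \<sigma> w])
  define q where "q = r \<cdot>\<^sub>v p"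
  have q: "q \<in> carrier_vec \<sigma>" using p by (simp add: q_def)
  \<comment> \<open>\<open>X\<close> and \<open>Xt\<close> are the two bracketed factors in
    \<Theta>, transposes of each other; each is the identity plus a rank-one update.\<close>
  define X where "X = 1\<^sub>m \<sigma> + (1 / Y11) \<cdot>\<^sub>m outer_prod yS zS"
  define Xt where "Xt = 1\<^sub>m \<sigma> + (1 / Y11) \<cdot>\<^sub>m outer_prod zS yS"
  have X: "X \<in> carrier_mat \<sigma> \<sigma>" "Xt \<in> carrier_mat \<sigma> \<sigma>"
    using yS zS by (simp_all add: X_def Xt_def)
  have Xv: "X *\<^sub>v w = w + ((zS \<bullet> w) / Y11) \<cdot>\<^sub>v yS" "Xt *\<^sub>v w = w + ((yS \<bullet> w) / Y11) \<cdot>\<^sub>v zS"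
    if "w \<in> carrier_vec \<sigma>" for w
    using yS zS that unfolding X_def Xt_def
    by (simp_all add: add_mult_distrib_mat_vec[of _ \<sigma> \<sigma>] smult_mat_mult_vec[of _ \<sigma> \<sigma>]
        outer_prod_mult_vec smult_smult_assoc)
  have Xc: "X *\<^sub>v w \<in> carrier_vec \<sigma>" "Xt *\<^sub>v w \<in> carrier_vec \<sigma>" if "w \<in> carrier_vec \<sigma>" for w
    using X that by auto
  define x where "x = E \<bullet> c"
  have cE: "c \<bullet> E = x" unfolding x_def using comm_scalar_prod[OF c' E] .
  have q_form: "c \<bullet> (transpose_mat B *\<^sub>v v) * r = v \<bullet> q" if "v \<in> carrier_vec \<sigma>" for v
    using Bt[OF that] that p by (simp add: q_def)
  have rBc: "(r \<cdot>\<^sub>m B) *\<^sub>v c = q" using B c' by (simp add: smult_mat_mult_vec[of _ \<sigma> k] q_def p_def)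
  have rBt: "c \<bullet> ((r \<cdot>\<^sub>m transpose_mat B) *\<^sub>v v) = v \<bullet> q" if "v \<in> carrier_vec \<sigma>" for v
    using B c' that q_form[OF that] BT'
    by (subst smult_mat_mult_vec[of _ k \<sigma>]) (auto simp: mult.commute)
  have form_add: "c \<bullet> ((P + R) *\<^sub>v c) = c \<bullet> (P *\<^sub>v c) + c \<bullet> (R *\<^sub>v c)"
    and form_diff: "c \<bullet> ((P - R) *\<^sub>v c) = c \<bullet> (P *\<^sub>v c) - c \<bullet> (R *\<^sub>v c)"
    if "P \<in> carrier_mat k k" "R \<in> carrier_mat k k" for P R
    using that c'
    by (simp_all add: add_mult_distrib_mat_vec[of _ k k] minus_mult_distrib_mat_vec[of _ k k]
        scalar_prod_add_distrib[of _ k] scalar_prod_minus_distrib[of _ k])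
  have form_smult: "c \<bullet> ((a \<cdot>\<^sub>m P) *\<^sub>v c) = a * (c \<bullet> (P *\<^sub>v c))"
    if "P \<in> carrier_mat k k" for a P
    using that c' by (simp add: smult_mat_mult_vec[of _ k k])
  have outerE: "c \<bullet> ((a \<cdot>\<^sub>m outer_prod E yS) *\<^sub>v v) = a * x * (yS \<bullet> v)" if "v \<in> carrier_vec \<sigma>" for a v
    using that E yS c'
    by (simp add: smult_mat_mult_vec[of _ k \<sigma>] outer_prod_mult_vec cE)
  have outer_yE: "(a \<cdot>\<^sub>m outer_prod yS E) *\<^sub>v c = (a * x) \<cdot>\<^sub>v yS" for a
    using E yS c'
    by (simp add: smult_mat_mult_vec[of _ \<sigma> k] outer_prod_mult_vec x_def smult_smult_assoc)

  have mult3: "P * Q * R *\<^sub>v c = P *\<^sub>v (Q *\<^sub>v (R *\<^sub>v c))"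
    if "P \<in> carrier_mat k \<sigma>" "Q \<in> carrier_mat \<sigma> \<sigma>" "R \<in> carrier_mat \<sigma> k" for P Q R :: "real mat"
  proof -
    have "P * Q \<in> carrier_mat k \<sigma>" "R *\<^sub>v c \<in> carrier_vec \<sigma>" using that c' by auto
    then show ?thesis
      using that c' by (simp add: assoc_mult_mat_vec[of _ k \<sigma> _ k] assoc_mult_mat_vec[of _ k \<sigma> _ \<sigma>])
  qed
  have mult4: "P * Q * Q' * R *\<^sub>v c = P *\<^sub>v (Q *\<^sub>v (Q' *\<^sub>v (R *\<^sub>v c)))"
    if "P \<in> carrier_mat k \<sigma>" "Q \<in> carrier_mat \<sigma> \<sigma>" "Q' \<in> carrier_mat \<sigma> \<sigma>" "R \<in> carrier_mat \<sigma> k"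
    for P Q Q' R :: "real mat"
  proof -
    have "P * Q \<in> carrier_mat k \<sigma>" "Q' *\<^sub>v (R *\<^sub>v c) \<in> carrier_vec \<sigma>" using that c' by auto
    then show ?thesis
      using that c' mult3[of "P * Q" Q' R] by (simp add: assoc_mult_mat_vec[of _ k \<sigma> _ \<sigma>])
  qed
  have ocar: "a \<cdot>\<^sub>m outer_prod E yS \<in> carrier_mat k \<sigma>" "a \<cdot>\<^sub>m outer_prod yS E \<in> carrier_mat \<sigma> k"
    "outer_prod E yS \<in> carrier_mat k \<sigma>" "outer_prod yS E \<in> carrier_mat \<sigma> k" for a
    using E yS by (simp_all add: smult_carrier_mat)
  \<comment> \<open>The numbers in \<open>?T2\<close> to \<open>?T8\<close> are the positions of the
    summands in \<Theta>, without the scalar factors in front of some of them. The sixth and seventh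
    are outer products with \<open>?w\<close> and get no abbreviation.\<close>
  let ?a = "1 / (\<delta> * real n * Y11)"
  let ?T2 = "?a \<cdot>\<^sub>m outer_prod E yS * H * X * (r \<cdot>\<^sub>m B)"
  let ?T3 = "outer_prod (r \<cdot>\<^sub>v E) (r \<cdot>\<^sub>v E)"
  let ?T4 = "r \<cdot>\<^sub>m transpose_mat B * Xt * H * (?a \<cdot>\<^sub>m outer_prod yS E)"
  let ?T5 = "outer_prod E yS * H * outer_prod yS E"
  let ?w = "r \<cdot>\<^sub>m transpose_mat B *\<^sub>v zS"
  let ?Z = "Xt * ((1 / \<delta>) \<cdot>\<^sub>m H) * X + (1 / Y11) \<cdot>\<^sub>m outer_prod zS zS"
  let ?T8 = "transpose_mat B * ?Z * B"
  have w: "?w \<in> carrier_vec k"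
    using BT' zS by (intro mult_mat_vec_carrier[of _ k \<sigma>] smult_carrier_mat)
  have Z: "?Z \<in> carrier_mat \<sigma> \<sigma>" using X H zS by simp
  have cars: "?T2 \<in> carrier_mat k k" "?T3 \<in> carrier_mat k k" "?T4 \<in> carrier_mat k k"
    "?T5 \<in> carrier_mat k k" "outer_prod (r \<cdot>\<^sub>v E) ?w \<in> carrier_mat k k"
    "outer_prod ?w (r \<cdot>\<^sub>v E) \<in> carrier_mat k k" "?T8 \<in> carrier_mat k k"
    using car X w Z by (auto intro!: mult_carrier_mat smult_carrier_mat outer_prod_carrier)
  have T2: "c \<bullet> (?T2 *\<^sub>v c) = ?a * x * (yS \<bullet> (H *\<^sub>v (X *\<^sub>v q)))"
  proof -
    have "?T2 *\<^sub>v c = ?a \<cdot>\<^sub>m outer_prod E yS *\<^sub>v (H *\<^sub>v (X *\<^sub>v q))"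
      using mult4[OF ocar(1) H X(1) smult_carrier_mat[OF B]] by (simp only: rBc)
    then show ?thesis using outerE[OF Hc[OF Xc(1)[OF q]]] by simp
  qed
  have T3: "c \<bullet> (?T3 *\<^sub>v c) = (r * x)\<^sup>2"
    using E c' by (simp add: outer_prod_mult_vec cE x_def power2_eq_square)
  have T4: "c \<bullet> (?T4 *\<^sub>v c) = ?a * x * ((Xt *\<^sub>v (H *\<^sub>v yS)) \<bullet> q)"
  proof -
    have "?T4 *\<^sub>v c = r \<cdot>\<^sub>m transpose_mat B *\<^sub>v (Xt *\<^sub>v (H *\<^sub>v ((?a * x) \<cdot>\<^sub>v yS)))"
      using mult4[OF smult_carrier_mat[OF BT'] X(2) H ocar(2)] by (simp only: outer_yE)
    also have "Xt *\<^sub>v (H *\<^sub>v ((?a * x) \<cdot>\<^sub>v yS)) = (?a * x) \<cdot>\<^sub>v (Xt *\<^sub>v (H *\<^sub>v yS))"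
      using H X yS by (simp add: mult_mat_vec[of _ \<sigma> \<sigma>])
    finally show ?thesis using rBt[of "(?a * x) \<cdot>\<^sub>v (Xt *\<^sub>v (H *\<^sub>v yS))"] Xc(2)[OF Hc[OF yS]] q
      by simp
  qed
  have T5: "c \<bullet> (?T5 *\<^sub>v c) = x * x * (yS \<bullet> (H *\<^sub>v yS))"
  proof -
    have "?T5 *\<^sub>v c = outer_prod E yS *\<^sub>v (H *\<^sub>v (x \<cdot>\<^sub>v yS))"
      using mult3[OF ocar(3) H ocar(4)] E c' by (simp add: outer_prod_mult_vec x_def)
    then show ?thesis using H yS E c' Hc[OF yS]
      by (simp add: mult_mat_vec[of _ \<sigma> \<sigma>] outer_prod_mult_vec cE)
  qed
  have wq: "?w \<bullet> c = zS \<bullet> q" "c \<bullet> ?w = zS \<bullet> q"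
    using rBt[OF zS] comm_scalar_prod[OF w c'] by simp_all
  have T6: "c \<bullet> (outer_prod (r \<cdot>\<^sub>v E) ?w *\<^sub>v c) = r * x * (zS \<bullet> q)"
    using E c' w wq by (simp add: outer_prod_mult_vec cE del: dim_mult_mat_vec)
  have T7: "c \<bullet> (outer_prod ?w (r \<cdot>\<^sub>v E) *\<^sub>v c) = r * x * (zS \<bullet> q)"
    using E c' w wq by (simp add: outer_prod_mult_vec x_def)
  have T8: "r\<^sup>2 * (c \<bullet> (?T8 *\<^sub>v c)) = ((Xt *\<^sub>v (H *\<^sub>v (X *\<^sub>v q))) \<bullet> q) / \<delta> + (zS \<bullet> q)\<^sup>2 / Y11"
  proof -
    have "?T8 *\<^sub>v c = transpose_mat B *\<^sub>v (?Z *\<^sub>v p)"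
      using mult3[OF BT' Z B] by (simp only: p_def)
    then have "r\<^sup>2 * (c \<bullet> (?T8 *\<^sub>v c)) = r * ((?Z *\<^sub>v p) \<bullet> q)"
      using q_form[of "?Z *\<^sub>v p"] Z p by (simp add: power2_eq_square mult_ac)
    also have "\<dots> = (?Z *\<^sub>v q) \<bullet> q"
      using mult_mat_vec[OF Z p, of r] smult_scalar_prod_distrib[OF mult_mat_vec_carrier[OF Z p] q, of r]
      by (simp only: q_def)
    also have "?Z *\<^sub>v q = (1 / \<delta>) \<cdot>\<^sub>v (Xt *\<^sub>v (H *\<^sub>v (X *\<^sub>v q))) + ((zS \<bullet> q) / Y11) \<cdot>\<^sub>v zS"
    proof -
      have dH: "(1 / \<delta>) \<cdot>\<^sub>m H \<in> carrier_mat \<sigma> \<sigma>" using H by simp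
      have XdH: "Xt * ((1 / \<delta>) \<cdot>\<^sub>m H) \<in> carrier_mat \<sigma> \<sigma>" using X dH by simp
      have "Xt * ((1 / \<delta>) \<cdot>\<^sub>m H) * X *\<^sub>v q = Xt *\<^sub>v (((1 / \<delta>) \<cdot>\<^sub>m H) *\<^sub>v (X *\<^sub>v q))"
        unfolding assoc_mult_mat_vec[OF XdH X(1) q] assoc_mult_mat_vec[OF X(2) dH Xc(1)[OF q]] ..
      also have "\<dots> = (1 / \<delta>) \<cdot>\<^sub>v (Xt *\<^sub>v (H *\<^sub>v (X *\<^sub>v q)))"
        using mult_mat_vec[OF X(2) Hc[OF Xc(1)[OF q]]] smult_mat_mult_vec[OF H Xc(1)[OF q]] by simp
      finally show ?thesis
        using add_mult_distrib_mat_vec[OF mult_carrier_mat[OF XdH X(1)]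
            smult_carrier_mat[OF outer_prod_carrier[OF zS zS]] q, of "1 / Y11"] zS q
        by (simp add: smult_mat_mult_vec[of _ \<sigma> \<sigma>] outer_prod_mult_vec smult_smult_assoc)
    qed
    finally show ?thesis using X H q zS Xc Hc
      by (simp add: add_scalar_prod_distrib[of _ \<sigma>] power2_eq_square)
  qed
  have "c \<bullet> (Theta_mat n d \<sigma> S M \<epsilon> yS zS Y11 \<delta> \<mu>2 *\<^sub>v c)
      = r * (c \<bullet> (D *\<^sub>v c)) - c \<bullet> (?T2 *\<^sub>v c) - 1 / Y11 * (c \<bullet> (?T3 *\<^sub>v c)) - c \<bullet> (?T4 *\<^sub>v c)
        - 1 / (\<delta> * (real n * Y11)\<^sup>2) * (c \<bullet> (?T5 *\<^sub>v c))
        - 1 / Y11 * (c \<bullet> (outer_prod (r \<cdot>\<^sub>v E) ?w *\<^sub>v c))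
        - 1 / Y11 * (c \<bullet> (outer_prod ?w (r \<cdot>\<^sub>v E) *\<^sub>v c))
        - r\<^sup>2 * (c \<bullet> (?T8 *\<^sub>v c)) + \<mu>2 * (c \<bullet> c)"
  proof -
    have form9: "c \<bullet> ((r \<cdot>\<^sub>m P1 - P2 - a3 \<cdot>\<^sub>m P3 - P4 - a5 \<cdot>\<^sub>m P5 - a6 \<cdot>\<^sub>m P6 - a7 \<cdot>\<^sub>m P7 - a8 \<cdot>\<^sub>m P8
          + \<mu>2 \<cdot>\<^sub>m 1\<^sub>m k) *\<^sub>v c)
        = r * (c \<bullet> (P1 *\<^sub>v c)) - c \<bullet> (P2 *\<^sub>v c) - a3 * (c \<bullet> (P3 *\<^sub>v c)) - c \<bullet> (P4 *\<^sub>v c)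
          - a5 * (c \<bullet> (P5 *\<^sub>v c)) - a6 * (c \<bullet> (P6 *\<^sub>v c)) - a7 * (c \<bullet> (P7 *\<^sub>v c))
          - a8 * (c \<bullet> (P8 *\<^sub>v c)) + \<mu>2 * (c \<bullet> c)"
      if "P1 \<in> carrier_mat k k" "P2 \<in> carrier_mat k k" "P3 \<in> carrier_mat k k" "P4 \<in> carrier_mat k k"
        "P5 \<in> carrier_mat k k" "P6 \<in> carrier_mat k k" "P7 \<in> carrier_mat k k" "P8 \<in> carrier_mat k k"
      for P1 P2 P3 P4 P5 P6 P7 P8 a3 a5 a6 a7 a8
      using that c' by (simp add: form_add form_diff form_smult minus_carrier_mat)
    have r2: "1 / (real n)\<^sup>2 = r\<^sup>2" by (simp add: r_def power_divide)
    show ?thesis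
      unfolding Theta_mat_def Let_def Sc_def[symmetric] k_def[symmetric]
        B_def[symmetric] D_def[symmetric] E_def[symmetric] H_def[symmetric] BT r_def[symmetric]
        X_def[symmetric] Xt_def[symmetric] r2
      using form9[OF D cars(1,2,3,4,5,6,7)] by simp
  qed
  also have "\<dots> = r * (c \<bullet> (D *\<^sub>v c)) + \<mu>2 * (c \<bullet> c) - (zS \<bullet> q + r * x)\<^sup>2 / Y11
      - (h \<bullet> (H *\<^sub>v h)) / \<delta>"
  proof -
    \<comment> \<open>This is the coefficient of \<open>yS\<close> in \<open>h\<close>. Facts 1 to 4
      reduce both sides to the same scalars: \<open>x\<close>, \<open>zS \<bullet> q\<close>, and
      the values of \<open>H\<close> on pairs from \<open>q\<close> and \<open>yS\<close>, so that
      only algebra remains.\<close>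
    define \<kappa> where "\<kappa> = (zS \<bullet> q + r * x) / Y11"
    have h: "h = q + \<kappa> \<cdot>\<^sub>v yS"
      by (simp add: h_def g_def u_def \<kappa>_def q_def p_def r_def B_def x_def E_def)
    note mv = mult_add_distrib_mat_vec[of _ \<sigma> \<sigma>] mult_mat_vec[of _ \<sigma> \<sigma>]
      add_scalar_prod_distrib[of _ \<sigma>] scalar_prod_add_distrib[of _ \<sigma>]
    have HX: "H *\<^sub>v (X *\<^sub>v q) = H *\<^sub>v q + ((zS \<bullet> q) / Y11) \<cdot>\<^sub>v (H *\<^sub>v yS)"
      using H q yS by (simp add: Xv mv)
    have yH: "yS \<bullet> (H *\<^sub>v q) = q \<bullet> (H *\<^sub>v yS)" by (rule Hsym[OF yS q])
    have Hcomm: "(H *\<^sub>v v) \<bullet> q = q \<bullet> (H *\<^sub>v v)" if "v \<in> carrier_vec \<sigma>" for v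
      using comm_scalar_prod[OF Hc[OF that] q] .
    have 1: "yS \<bullet> (H *\<^sub>v (X *\<^sub>v q)) = q \<bullet> (H *\<^sub>v yS) + (zS \<bullet> q) / Y11 * (yS \<bullet> (H *\<^sub>v yS))"
      unfolding HX using Hc q yS by (simp add: mv yH)
    have 2: "(Xt *\<^sub>v (H *\<^sub>v yS)) \<bullet> q = q \<bullet> (H *\<^sub>v yS) + (yS \<bullet> (H *\<^sub>v yS)) / Y11 * (zS \<bullet> q)"
      using Hc q yS zS by (simp add: mv Xv Hcomm)
    have "(Xt *\<^sub>v (H *\<^sub>v (X *\<^sub>v q))) \<bullet> q
        = q \<bullet> (H *\<^sub>v (X *\<^sub>v q)) + (yS \<bullet> (H *\<^sub>v (X *\<^sub>v q))) / Y11 * (zS \<bullet> q)"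
      using Hc Xc q zS by (simp add: Xv(2) mv Hcomm)
    also have "q \<bullet> (H *\<^sub>v (X *\<^sub>v q)) = q \<bullet> (H *\<^sub>v q) + (zS \<bullet> q) / Y11 * (q \<bullet> (H *\<^sub>v yS))"
      unfolding HX using Hc q yS by (simp add: mv)
    finally have 3: "(Xt *\<^sub>v (H *\<^sub>v (X *\<^sub>v q))) \<bullet> q
        = q \<bullet> (H *\<^sub>v q) + (zS \<bullet> q) / Y11 * (q \<bullet> (H *\<^sub>v yS))
          + (q \<bullet> (H *\<^sub>v yS) + (zS \<bullet> q) / Y11 * (yS \<bullet> (H *\<^sub>v yS))) / Y11 * (zS \<bullet> q)"
      unfolding 1 .
    have 4: "h \<bullet> (H *\<^sub>v h) = q \<bullet> (H *\<^sub>v q) + 2 * \<kappa> * (q \<bullet> (H *\<^sub>v yS)) + \<kappa>\<^sup>2 * (yS \<bullet> (H *\<^sub>v yS))"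
      unfolding h using H Hc q yS by (simp add: mv yH power2_eq_square algebra_simps)
    have a: "?a = r / (\<delta> * Y11)" "1 / (\<delta> * (real n * Y11)\<^sup>2) = r\<^sup>2 / (\<delta> * Y11\<^sup>2)"
      by (simp_all add: r_def power_divide power_mult_distrib)
    show ?thesis
      unfolding T2 T3 T4 T5 T6 T7 T8
      unfolding 1 2 3 4 a \<kappa>_def
      by (simp add: divide_inverse power2_eq_square algebra_simps)
  qed
  finally show ?thesis
    by (simp add: g_def u_def q_def p_def r_def B_def D_def H_def x_def E_def)
qed

subsection \<open>The dual certificate\<close>

text \<open>The data in coordinates, indexed by the original positions: \<open>G\<close> and
  \<open>e\<close> stand for \<open>M\<^sup>T M / n\<close> and
  \<open>M\<^sup>T \<epsilon> / n\<close>, \<theta> for the entries of \<Theta>2, and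
  \<open>lam\<close> for the smallest eigenvalue of the block of \<open>G\<close> on
  \<open>S\<close>. Condition (E1) appears as \<open>e_le\<close>, and \<open>\<mu>3_le\<close>
  unfolds the minimum in \<mu>3, where \<open>e i / z i = e i * z i\<close> because
  \<open>z i\<close> is a sign.\<close>

locale sils_certificate =
  fixes d :: nat and S :: "nat set" and G \<theta> :: "nat \<Rightarrow> nat \<Rightarrow> real" and z e y :: "nat \<Rightarrow> real"
    and Y11 \<delta> lam \<mu>2 \<mu>3 :: real
  assumes S: "S \<subseteq> {..<d}" "S \<noteq> {}"
    and G_sym: "\<And>i j. i < d \<Longrightarrow> j < d \<Longrightarrow> G i j = G j i"
    and z_sq: "\<And>i. i \<in> S \<Longrightarrow> z i * z i = 1"
    and z_off: "\<And>i. i < d \<Longrightarrow> i \<notin> S \<Longrightarrow> z i = 0"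
    and y_eq: "\<And>i. i < d \<Longrightarrow> y i = - (\<Sum>j\<in>S. G i j * z j) - e i"
    and Y11_eq: "Y11 = - (\<Sum>i\<in>S. y i * z i)" and Y11_pos: "0 < Y11"
    and \<delta>_pos: "0 < \<delta>"
    and G_ge: "\<And>v. lam * (\<Sum>i\<in>S. (v i)\<^sup>2) \<le> (\<Sum>i\<in>S. \<Sum>j\<in>S. v i * G i j * v j)"
    and \<mu>3_le: "\<And>i. i \<in> S \<Longrightarrow> real (card S) * \<mu>3 \<le> lam - \<delta> + e i * z i"
    and \<mu>3_nonneg: "0 \<le> \<mu>3"
    and \<mu>2_le: "\<mu>2 \<le> \<delta> - lam"
    and e_le: "\<And>i. i < d \<Longrightarrow> i \<notin> S \<Longrightarrow> \<bar>e i\<bar> \<le> real (card S) * \<mu>3"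
    and \<theta>_le: "\<And>i j. i < d \<Longrightarrow> i \<notin> S \<Longrightarrow> j < d \<Longrightarrow> j \<notin> S \<Longrightarrow> \<bar>\<theta> i j\<bar> \<le> \<mu>3"
begin

abbreviation "T \<equiv> {..<d} - S"
abbreviation "s \<equiv> real (card S)"

text \<open>For \<open>x\<close> on the complement of \<open>S\<close>, these are the coordinate
  versions of the quantities \<open>g\<close>, \<open>u\<close>, \<open>zS \<bullet> g\<close> and
  \<open>h\<close> in \<open>Theta_mat_form\<close>.\<close>

definition "g x i = (\<Sum>j\<in>T. G i j * x j)"
definition "u x = (\<Sum>j\<in>T. e j * x j)"
definition "zg x = (\<Sum>i\<in>S. z i * g x i)"
definition "h x i = g x i + (zg x + u x) / Y11 * y i"

text \<open>This is the form of \<Theta>. The bracket over \<delta> is the form of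
  \<open>H\<^sup>0\<close> at \<open>h x\<close>, since the inner product of \<open>z\<close> and
  \<open>h x\<close> on \<open>S\<close> is \<open>- u x\<close>.\<close>

definition schur :: "(nat \<Rightarrow> real) \<Rightarrow> real" where
  "schur x = (\<Sum>i\<in>T. \<Sum>j\<in>T. x i * G i j * x j) + \<mu>2 * (\<Sum>i\<in>T. (x i)\<^sup>2)
     - (zg x + u x)\<^sup>2 / Y11 - ((\<Sum>i\<in>S. (h x i)\<^sup>2) - (u x)\<^sup>2 / s) / \<delta>"

text \<open>\<open>R\<close> is \<open>\<mu>3\<close> times a subgradient of the entrywise \<open>1\<close>-norm at \<open>z z\<^sup>T\<close>, and \<open>p\<close> is the
  multiplier of the diagonal constraint; the blocks are forced by \<open>Y (1, z) = 0\<close> except for \<open>\<theta>\<close>.\<close>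

definition R :: "nat \<Rightarrow> nat \<Rightarrow> real" where
  "R i j = (if i \<in> S then if j \<in> S then \<mu>3 * z i * z j else z i * e j / s
    else if j \<in> S then e i * z j / s else - \<theta> i j)"

definition p :: "nat \<Rightarrow> real" where
  "p i = (if i \<in> S then e i * z i - \<mu>2 - s * \<mu>3 else 0)"

definition Yx :: "nat \<Rightarrow> nat \<Rightarrow> real" where
  "Yx i j = G i j + R i j + (if i = j then \<mu>2 + p i else 0)"

text \<open>The form at \<open>(t, x)\<close> of the dual slack matrix \<open>Y\<close> with corner
  \<open>Y11\<close>, border \<open>y\<close> and lower right block \<open>Yx\<close>.\<close>

definition F :: "real \<Rightarrow> (nat \<Rightarrow> real) \<Rightarrow> real" where
  "F t x = Y11 * t\<^sup>2 + 2 * t * (\<Sum>i<d. y i * x i) + (\<Sum>i<d. \<Sum>j<d. Yx i j * (x i * x j))"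

section \<open>Block expansion and lower bound of the slack form\<close>

lemma finite_S [simp]: "finite S" using S(1) finite_subset by blast

lemma s_pos: "0 < s" using S(2) by (simp add: card_gt_0_iff)

lemma sum_z_sq: "(\<Sum>i\<in>S. z i * z i) = s" using z_sq by simp

lemma sum_split: "(\<Sum>i<d. f i) = (\<Sum>i\<in>S. f i) + (\<Sum>i\<in>T. f i)" for f :: "nat \<Rightarrow> real"
  using S(1) by (metis add.commute finite_lessThan sum.subset_diff)

lemma F_blocks:
  "F t x = Y11 * t\<^sup>2 + 2 * t * ((\<Sum>i\<in>S. y i * x i) - zg x - u x)
    + (\<Sum>i\<in>S. \<Sum>j\<in>S. x i * G i j * x j) + \<mu>3 * (\<Sum>i\<in>S. z i * x i)\<^sup>2
    + (\<Sum>i\<in>S. (e i * z i - s * \<mu>3) * (x i)\<^sup>2)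
    + 2 * ((\<Sum>i\<in>S. x i * g x i) + (\<Sum>i\<in>S. z i * x i) * u x / s)
    + (\<Sum>i\<in>T. \<Sum>j\<in>T. x i * G i j * x j) + \<mu>2 * (\<Sum>i\<in>T. (x i)\<^sup>2)
    - (\<Sum>i\<in>T. \<Sum>j\<in>T. x i * \<theta> i j * x j)"
proof -
  have SltD: "i < d" if "i \<in> S" for i using that S(1) by auto
  \<comment> \<open>On \<open>S\<close> the \<mu>2 inside \<open>p\<close> cancels the \<mu>2 of the
    trace multiplier; off \<open>S\<close>, where \<open>p\<close> is 0, it survives.\<close>
  have diag: "(\<Sum>i<d. \<Sum>j<d. (if i = j then \<mu>2 + p i else 0) * (x i * x j))
      = (\<Sum>i\<in>S. (e i * z i - s * \<mu>3) * (x i)\<^sup>2) + \<mu>2 * (\<Sum>i\<in>T. (x i)\<^sup>2)"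
  proof -
    have "(\<Sum>j<d. (if i = j then \<mu>2 + p i else 0) * (x i * x j)) = (\<mu>2 + p i) * (x i)\<^sup>2"
      if "i < d" for i
    proof -
      have "(\<Sum>j<d. (if i = j then \<mu>2 + p i else 0) * (x i * x j))
          = (\<Sum>j<d. if i = j then (\<mu>2 + p i) * (x i * x j) else 0)"
        by (rule sum.cong) auto
      then show ?thesis using that by (simp add: power2_eq_square)
    qed
    then have "(\<Sum>i<d. \<Sum>j<d. (if i = j then \<mu>2 + p i else 0) * (x i * x j))
        = (\<Sum>i<d. (\<mu>2 + p i) * (x i)\<^sup>2)" by simp
    then show ?thesis by (simp add: sum_split p_def sum_distrib_left)
  qed
  have cross: "(\<Sum>i\<in>T. \<Sum>j\<in>S. (G i j + R i j) * (x i * x j))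
      = (\<Sum>i\<in>S. \<Sum>j\<in>T. (G i j + R i j) * (x i * x j))"
    by (subst sum.swap) (auto intro!: sum.cong simp: R_def SltD G_sym)
  have ST: "(\<Sum>i\<in>S. \<Sum>j\<in>T. (G i j + R i j) * (x i * x j))
      = (\<Sum>i\<in>S. x i * g x i) + (\<Sum>i\<in>S. z i * x i) * u x / s"
  proof -
    have "(\<Sum>i\<in>S. \<Sum>j\<in>T. (G i j + R i j) * (x i * x j))
        = (\<Sum>i\<in>S. \<Sum>j\<in>T. x i * (G i j * x j) + (z i * x i) * (e j * x j) / s)"
      by (intro sum.cong) (auto simp: R_def field_simps)
    also have "\<dots> = (\<Sum>i\<in>S. x i * g x i) + (\<Sum>i\<in>S. z i * x i) * u x / s"
      unfolding g_def u_def
      by (simp add: sum.distrib sum_distrib_left[symmetric])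
        (simp add: sum_product sum_divide_distrib)
    finally show ?thesis .
  qed
  have SS: "(\<Sum>i\<in>S. \<Sum>j\<in>S. (G i j + R i j) * (x i * x j))
      = (\<Sum>i\<in>S. \<Sum>j\<in>S. x i * G i j * x j) + \<mu>3 * (\<Sum>i\<in>S. z i * x i)\<^sup>2"
    by (simp add: R_def power2_eq_square sum_product sum_distrib_left sum.distrib algebra_simps)
  have TT: "(\<Sum>i\<in>T. \<Sum>j\<in>T. (G i j + R i j) * (x i * x j))
      = (\<Sum>i\<in>T. \<Sum>j\<in>T. x i * G i j * x j) - (\<Sum>i\<in>T. \<Sum>j\<in>T. x i * \<theta> i j * x j)"
    by (simp add: R_def sum_subtractf algebra_simps)
  have quad: "(\<Sum>i<d. \<Sum>j<d. Yx i j * (x i * x j))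
      = (\<Sum>i<d. \<Sum>j<d. (G i j + R i j) * (x i * x j))
        + (\<Sum>i<d. \<Sum>j<d. (if i = j then \<mu>2 + p i else 0) * (x i * x j))"
    unfolding Yx_def by (simp add: distrib_right sum.distrib)
  \<comment> \<open>By symmetry of \<open>G\<close>, inserting the formula for \<open>y\<close>
    moves \<open>G\<close> from \<open>z\<close> onto \<open>x\<close>.\<close>
  have yT: "(\<Sum>i\<in>T. y i * x i) = - zg x - u x"
  proof -
    have "(\<Sum>i\<in>T. y i * x i) = (\<Sum>i\<in>T. - (\<Sum>j\<in>S. z j * (G j i * x i)) - e i * x i)"
    proof (rule sum.cong)
      fix i assume "i \<in> T"
      then have "(\<Sum>j\<in>S. G i j * z j) * x i = (\<Sum>j\<in>S. z j * (G j i * x i))"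
        unfolding sum_distrib_right by (intro sum.cong) (auto simp: SltD G_sym)
      then show "y i * x i = - (\<Sum>j\<in>S. z j * (G j i * x i)) - e i * x i"
        using \<open>i \<in> T\<close> by (simp add: y_eq algebra_simps)
    qed simp
    also have "\<dots> = - (\<Sum>j\<in>S. \<Sum>i\<in>T. z j * (G j i * x i)) - u x"
      unfolding u_def sum_subtractf sum_negf by (subst sum.swap) simp
    finally show ?thesis by (simp add: zg_def g_def sum_distrib_left)
  qed
  show ?thesis
    unfolding F_def quad diag
    unfolding sum_split[of "\<lambda>i. y i * x i"] yT
    unfolding sum_split sum.distrib cross ST SS TT
    by (simp add: algebra_simps)
qed

text \<open>The equation for \<open>y\<close> gives \<open>Y11\<close> minus the sum of
  \<open>e i * z i\<close> for the form of \<open>G\<close> at \<open>z\<close>. The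
  \<open>e\<close> part cancels against the diagonal, the \<mu>3 parts cancel each other, and the
  corner, twice the border and this form add up to \<open>Y11 - 2 * Y11 + Y11\<close>.\<close>

lemma F_certificate: "F 1 z = 0"
proof -
  have z0: "z i = 0" if "i \<in> T" for i using that z_off by auto
  have g0: "g z i = 0" and u0: "u z = 0" for i
    unfolding g_def u_def using z0 by (auto intro!: sum.neutral)
  have zg0: "zg z = 0" by (simp add: zg_def g0)
  note gz = g0 u0 zg0
  have 1: "(\<Sum>i\<in>S. \<Sum>j\<in>S. z i * G i j * z j) = Y11 - (\<Sum>i\<in>S. e i * z i)"
  proof -
    have "(\<Sum>i\<in>S. \<Sum>j\<in>S. z i * G i j * z j) = (\<Sum>i\<in>S. - (y i * z i) - e i * z i)"
    proof (rule sum.cong)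
      fix i assume "i \<in> S"
      then have Gz: "(\<Sum>j\<in>S. G i j * z j) = - y i - e i" using y_eq[of i] S(1) by auto
      have "(\<Sum>j\<in>S. z i * G i j * z j) = z i * (\<Sum>j\<in>S. G i j * z j)"
        by (simp add: sum_distrib_left mult.assoc)
      then show "(\<Sum>j\<in>S. z i * G i j * z j) = - (y i * z i) - e i * z i"
        unfolding Gz by (simp add: algebra_simps)
    qed simp
    then show ?thesis by (simp add: Y11_eq sum_subtractf sum_negf)
  qed
  have 2: "(\<Sum>i\<in>S. (e i * z i - s * \<mu>3) * (z i)\<^sup>2) = (\<Sum>i\<in>S. e i * z i) - s * (s * \<mu>3)"
    using z_sq by (simp add: power2_eq_square sum_subtractf)
  have 3: "(\<Sum>i\<in>S. y i * z i) = - Y11" by (simp add: Y11_eq)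
  have 4: "(\<Sum>i\<in>T. \<Sum>j\<in>T. z i * A i j * z j) = 0" for A :: "nat \<Rightarrow> nat \<Rightarrow> real"
    by (intro sum.neutral ballI) (simp add: z0)
  have 5: "(\<Sum>i\<in>T. (z i)\<^sup>2) = 0" by (rule sum.neutral) (simp add: z0)
  show ?thesis
    unfolding F_blocks gz 1 2 3 4 5 sum_z_sq by (simp add: power2_eq_square)
qed

text \<open>Pairing \<open>z\<close> with \<open>y\<close> on \<open>S\<close> gives
  \<open>- Y11\<close>, so the multiple of \<open>y\<close> in \<open>h\<close> removes
  \<open>zg x\<close> and leaves only \<open>- u x\<close>.\<close>

lemma sum_z_h: "(\<Sum>i\<in>S. z i * h x i) = - u x"
proof -
  have "(\<Sum>i\<in>S. z i * h x i) = (\<Sum>i\<in>S. z i * g x i + (zg x + u x) / Y11 * (y i * z i))"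
    by (rule sum.cong) (simp_all add: h_def algebra_simps)
  also have "\<dots> = zg x + (zg x + u x) / Y11 * (\<Sum>i\<in>S. y i * z i)"
    by (simp only: sum.distrib sum_distrib_left[symmetric] zg_def)
  finally show ?thesis using Y11_pos by (simp add: Y11_eq)
qed

text \<open>\<open>F\<close> is invariant under shifts by \<open>(1, z)\<close>; we shift \<open>x\<close> to be orthogonal to \<open>y\<close> on \<open>S\<close> and
  then complete squares, which is where the projection \<open>H\<^sup>0\<close> and the factor \<open>1 / \<delta>\<close> arise.\<close>

definition sh :: "(nat \<Rightarrow> real) \<Rightarrow> nat \<Rightarrow> real" where
  "sh x i = x i + (\<Sum>i\<in>S. y i * x i) / Y11 * z i"

definition \<beta> :: "(nat \<Rightarrow> real) \<Rightarrow> real" where "\<beta> x = (\<Sum>i\<in>S. z i * sh x i)"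

text \<open>Two squares are completed: one in \<open>t\<close> with pivot \<open>Y11\<close>, one on
  \<open>S\<close> with pivot \<delta>. Inside the second,
  \<open>sh x i - \<beta> x * z i / s\<close> and \<open>h x i + u x * z i / s\<close> are the
  projections by \<open>H\<^sup>0\<close> of \<open>sh x\<close> and \<open>h x\<close>, the latter
  by \<open>sum_z_h\<close>.\<close>

lemma F_lower_bound:
  "Y11 * (t + ((\<Sum>i\<in>S. y i * x i) - zg x - u x) / Y11)\<^sup>2
    + (\<Sum>i\<in>S. (\<delta> * (sh x i - \<beta> x * z i / s) + h x i + u x * z i / s)\<^sup>2) / \<delta>
    + (schur x - (\<Sum>i\<in>T. \<Sum>j\<in>T. x i * \<theta> i j * x j)) \<le> F t x"
proof -
  define k where "k = (\<Sum>i\<in>S. y i * x i) / Y11"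
  have k: "(\<Sum>i\<in>S. y i * x i) = k * Y11" using Y11_pos by (simp add: k_def)
  define v where "v = sh x"
  have x: "x i = v i - k * z i" for i by (simp add: v_def sh_def k_def)
  define b where "b = (\<Sum>i\<in>S. z i * v i)"
  have b: "\<beta> x = b" by (simp add: b_def \<beta>_def v_def)
  define ez where "ez = (\<Sum>i\<in>S. e i * z i)"
  define ev where "ev = (\<Sum>i\<in>S. e i * v i)"
  have yz: "(\<Sum>i\<in>S. y i * z i) = - Y11" by (simp add: Y11_eq)
  \<comment> \<open>The shift was chosen for this orthogonality: it decouples \<open>v\<close> from
    \<open>t\<close> and lets \<open>g\<close> replace \<open>h\<close> in products with
    \<open>v\<close>.\<close>
  have yv: "(\<Sum>i\<in>S. y i * v i) = 0"
  proof -
    have "(\<Sum>i\<in>S. y i * v i) = (\<Sum>i\<in>S. y i * x i + k * (y i * z i))"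
      by (rule sum.cong) (simp_all add: x algebra_simps)
    then show ?thesis by (simp add: sum.distrib sum_distrib_left[symmetric] k yz)
  qed
  have Gz: "(\<Sum>j\<in>S. G i j * z j) = - y i - e i" if "i \<in> S" for i
    using y_eq[of i] that S(1) by auto
  have vGz: "(\<Sum>i\<in>S. \<Sum>j\<in>S. w i * G i j * z j) = - (\<Sum>i\<in>S. y i * w i) - (\<Sum>i\<in>S. e i * w i)" for w
  proof -
    have "(\<Sum>i\<in>S. \<Sum>j\<in>S. w i * G i j * z j) = (\<Sum>i\<in>S. w i * (\<Sum>j\<in>S. G i j * z j))"
      by (simp add: sum_distrib_left mult.assoc)
    also have "\<dots> = (\<Sum>i\<in>S. - (y i * w i) - e i * w i)"
      by (rule sum.cong) (simp, subst Gz, simp_all add: algebra_simps)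
    finally show ?thesis by (simp add: sum_subtractf sum_negf)
  qed
  have zGw: "(\<Sum>i\<in>S. \<Sum>j\<in>S. z i * G i j * w j) = (\<Sum>i\<in>S. \<Sum>j\<in>S. w i * G i j * z j)" for w
    by (subst sum.swap) (use S(1) G_sym in \<open>auto intro!: sum.cong simp: mult_ac subset_iff\<close>)
  define P where "P = (\<Sum>i\<in>S. \<Sum>j\<in>S. v i * G i j * v j)"
  have 1: "(\<Sum>i\<in>S. \<Sum>j\<in>S. x i * G i j * x j) = P + 2 * k * ev + k\<^sup>2 * (Y11 - ez)"
  proof -
    have "(\<Sum>i\<in>S. \<Sum>j\<in>S. x i * G i j * x j)
        = (\<Sum>i\<in>S. \<Sum>j\<in>S. v i * G i j * v j - k * (v i * G i j * z j) - k * (z i * G i j * v j)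
            + k * k * (z i * G i j * z j))"
      by (intro sum.cong refl) (simp add: x algebra_simps)
    also have "\<dots> = P - k * (\<Sum>i\<in>S. \<Sum>j\<in>S. v i * G i j * z j) - k * (\<Sum>i\<in>S. \<Sum>j\<in>S. z i * G i j * v j)
          + k * k * (\<Sum>i\<in>S. \<Sum>j\<in>S. z i * G i j * z j)"
      unfolding P_def by (simp only: sum.distrib sum_subtractf sum_distrib_left)
    finally show ?thesis
      unfolding zGw[of v] vGz yv yz ev_def[symmetric] ez_def[symmetric]
      by (simp add: power2_eq_square algebra_simps)
  qed
  have 2: "(\<Sum>i\<in>S. z i * x i) = b - k * s"
  proof -
    have "(\<Sum>i\<in>S. z i * x i) = (\<Sum>i\<in>S. z i * v i - k * (z i * z i))"
      by (rule sum.cong) (simp_all add: x algebra_simps)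
    then show ?thesis by (simp add: sum_subtractf sum_distrib_left[symmetric] sum_z_sq b_def)
  qed
  define V where "V = (\<Sum>i\<in>S. (e i * z i - s * \<mu>3) * (v i)\<^sup>2)"
  have 3: "(\<Sum>i\<in>S. (e i * z i - s * \<mu>3) * (x i)\<^sup>2)
      = V - 2 * k * (ev - s * \<mu>3 * b) + k\<^sup>2 * (ez - s * \<mu>3 * s)"
  proof -
    have "(\<Sum>i\<in>S. (e i * z i - s * \<mu>3) * (x i)\<^sup>2)
        = (\<Sum>i\<in>S. (e i * z i - s * \<mu>3) * (v i)\<^sup>2 - 2 * k * (e i * v i * (z i * z i) - s * \<mu>3 * (z i * v i))
            + k\<^sup>2 * (e i * z i * (z i * z i) - s * \<mu>3 * (z i * z i)))"
      by (rule sum.cong) (simp_all add: x power2_eq_square algebra_simps)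
    also have "\<dots> = (\<Sum>i\<in>S. (e i * z i - s * \<mu>3) * (v i)\<^sup>2 - 2 * k * (e i * v i - s * \<mu>3 * (z i * v i))
            + k\<^sup>2 * (e i * z i - s * \<mu>3))"
      by (rule sum.cong) (simp_all add: z_sq)
    also have "\<dots> = V - 2 * k * (\<Sum>i\<in>S. e i * v i - s * \<mu>3 * (z i * v i))
        + k\<^sup>2 * (\<Sum>i\<in>S. e i * z i - s * \<mu>3)"
      unfolding sum_distrib_left V_def by (simp add: sum.distrib sum_subtractf)
    finally show ?thesis
      by (simp add: sum_subtractf sum_distrib_left[symmetric] ev_def ez_def b_def mult.assoc)
  qed
  define vg where "vg = (\<Sum>i\<in>S. v i * g x i)"
  have 4: "(\<Sum>i\<in>S. x i * g x i) = vg - k * zg x"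
  proof -
    have "(\<Sum>i\<in>S. x i * g x i) = (\<Sum>i\<in>S. v i * g x i - k * (z i * g x i))"
      by (rule sum.cong) (simp_all add: x algebra_simps)
    then show ?thesis by (simp add: sum_subtractf sum_distrib_left[symmetric] zg_def vg_def)
  qed
  note zh = sum_z_h[of x]
  have vh: "(\<Sum>i\<in>S. v i * h x i) = vg"
  proof -
    have "(\<Sum>i\<in>S. v i * h x i) = (\<Sum>i\<in>S. v i * g x i + (zg x + u x) / Y11 * (y i * v i))"
      by (rule sum.cong) (simp_all add: h_def algebra_simps)
    also have "\<dots> = vg + (zg x + u x) / Y11 * 0"
      by (simp only: sum.distrib sum_distrib_left[symmetric] yv vg_def)
    finally show ?thesis by simp
  qed
  define n2 where "n2 = (\<Sum>i\<in>S. (v i)\<^sup>2)"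
  define hh where "hh = (\<Sum>i\<in>S. (h x i)\<^sup>2)"
  \<comment> \<open>The total coefficient of \<open>z i\<close> inside the square, whose base thus
    becomes \<open>\<delta> * v i + h x i + c * z i\<close>.\<close>
  define c where "c = (u x - \<delta> * b) / s"
  have cs: "c * s = u x - \<delta> * b" using S(2) by (simp add: c_def)
  have sq: "(\<Sum>i\<in>S. (\<delta> * (sh x i - \<beta> x * z i / s) + h x i + u x * z i / s)\<^sup>2)
      = \<delta>\<^sup>2 * n2 + hh + c\<^sup>2 * s + 2 * \<delta> * vg + 2 * c * (\<delta> * b - u x)"
  proof -
    have "(\<delta> * (sh x i - \<beta> x * z i / s) + h x i + u x * z i / s)\<^sup>2
        = \<delta>\<^sup>2 * (v i)\<^sup>2 + (h x i)\<^sup>2 + c\<^sup>2 * (z i * z i) + 2 * \<delta> * (v i * h x i)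
          + 2 * c * \<delta> * (z i * v i) + 2 * c * (z i * h x i)" for i
    proof -
      have lin: "\<delta> * (sh x i - \<beta> x * z i / s) + h x i + u x * z i / s = \<delta> * v i + h x i + c * z i"
        unfolding b v_def[symmetric] c_def by (simp add: diff_divide_distrib algebra_simps)
      show ?thesis unfolding lin by (simp add: power2_eq_square algebra_simps)
    qed
    then have "(\<Sum>i\<in>S. (\<delta> * (sh x i - \<beta> x * z i / s) + h x i + u x * z i / s)\<^sup>2)
        = \<delta>\<^sup>2 * n2 + hh + c\<^sup>2 * s + 2 * \<delta> * vg + 2 * c * \<delta> * b + 2 * c * (- u x)"
      by (simp only: sum.distrib sum_distrib_left[symmetric] sum_z_sq zh vh n2_def hh_def b_def)
    then show ?thesis by (simp add: algebra_simps)
  qed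
  \<comment> \<open>The block of \<open>S\<close> dominates \<delta> times the identity:
    \<open>G\<close> contributes at least \<open>lam\<close>, and the diagonal coefficients at least
    \<open>\<delta> - lam\<close> by the choice of \<mu>3.\<close>
  have key: "\<delta> * n2 \<le> P + \<mu>3 * b\<^sup>2 + V"
  proof -
    have "lam * n2 \<le> P" unfolding n2_def P_def by (rule G_ge)
    moreover have "(\<Sum>i\<in>S. (\<delta> - lam) * (v i)\<^sup>2) \<le> V"
      unfolding V_def
    proof (rule sum_mono)
      fix i assume "i \<in> S"
      then have "\<delta> - lam \<le> e i * z i - s * \<mu>3" using \<mu>3_le[of i] by simp
      then show "(\<delta> - lam) * (v i)\<^sup>2 \<le> (e i * z i - s * \<mu>3) * (v i)\<^sup>2"
        by (rule mult_right_mono) simp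
    qed
    then have "(\<delta> - lam) * n2 \<le> V" by (simp add: n2_def sum_distrib_left)
    moreover have "0 \<le> \<mu>3 * b\<^sup>2" using \<mu>3_nonneg by simp
    ultimately show ?thesis by (simp add: algebra_simps)
  qed
  have Feq: "F t x = Y11 * (t + (k * Y11 - zg x - u x) / Y11)\<^sup>2
      + P + \<mu>3 * b\<^sup>2 + V + 2 * vg + 2 * b * u x / s
      + (\<Sum>i\<in>T. \<Sum>j\<in>T. x i * G i j * x j) + \<mu>2 * (\<Sum>i\<in>T. (x i)\<^sup>2) - (zg x + u x)\<^sup>2 / Y11
      - (\<Sum>i\<in>T. \<Sum>j\<in>T. x i * \<theta> i j * x j)"
  proof -
    have sq1: "Y11 * (t + (k * Y11 - zg x - u x) / Y11)\<^sup>2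
        = Y11 * t\<^sup>2 + 2 * t * (k * Y11 - zg x - u x) + k\<^sup>2 * Y11 - 2 * k * (zg x + u x)
          + (zg x + u x)\<^sup>2 / Y11"
      using Y11_pos by (simp add: power2_eq_square field_simps)
    have sq2: "(b - k * s) * u x / s = b * u x / s - k * u x"
      using S(2) by (simp add: field_simps)
    show ?thesis
      unfolding F_blocks 1 2 3 4 k sq1 sq2 by (simp add: power2_eq_square algebra_simps)
  qed
  have sq': "(\<delta>\<^sup>2 * n2 + hh + c\<^sup>2 * s + 2 * \<delta> * vg + 2 * c * (\<delta> * b - u x)) / \<delta> - (hh - (u x)\<^sup>2 / s) / \<delta>
      = \<delta> * n2 + 2 * vg + 2 * b * u x / s - \<delta> * b\<^sup>2 / s"
  proof -
    have u: "u x = c * s + \<delta> * b" using cs by simp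
    show ?thesis unfolding u using S(2) \<delta>_pos by (simp add: field_simps power2_eq_square)
  qed
  \<comment> \<open>The squares need only the form of \<open>\<delta> H\<^sup>0\<close> at
    \<open>v\<close>, that is \<open>\<delta> * (n2 - b\<^sup>2 / s)\<close>, whereas
    \<open>key\<close> supplies \<open>\<delta> * n2\<close>; the difference is dropped.\<close>
  have "0 \<le> \<delta> * b\<^sup>2 / s" using \<delta>_pos s_pos by simp
  then show ?thesis
    unfolding sq Feq schur_def hh_def[symmetric] k using key sq' by linarith
qed

text \<open>The form of \<Theta> - \<Theta>2, which is the form of \<Theta>1.\<close>

definition schur_gap :: "(nat \<Rightarrow> real) \<Rightarrow> real" where
  "schur_gap x = schur x - (\<Sum>i\<in>T. \<Sum>j\<in>T. x i * \<theta> i j * x j)"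

lemma schur_gap_le_F: "schur_gap x \<le> F t x"
proof -
  have "0 \<le> Y11 * (t + ((\<Sum>i\<in>S. y i * x i) - zg x - u x) / Y11)\<^sup>2" using Y11_pos by simp
  moreover have "0 \<le> (\<Sum>i\<in>S. (\<delta> * (sh x i - \<beta> x * z i / s) + h x i + u x * z i / s)\<^sup>2) / \<delta>"
    using \<delta>_pos by (intro divide_nonneg_pos sum_nonneg) auto
  ultimately show ?thesis using F_lower_bound[of t x] by (simp add: schur_gap_def)
qed

text \<open>When \<open>x\<close> vanishes on \<open>T\<close>, the Schur terms vanish too, so both
  squares in \<open>F_lower_bound\<close> are 0. The second puts the shifted vector on
  \<open>S\<close> in the kernel of \<open>H\<^sup>0\<close>, the multiples of \<open>z\<close>; the
  first ties the shift to \<open>t\<close>. Pairing with \<open>y\<close> then excludes any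
  remaining multiple of \<open>z\<close>.\<close>

lemma F_eq_0_imp:
  assumes F: "F t x = 0" and xT: "\<And>i. i \<in> T \<Longrightarrow> x i = 0" and i: "i < d"
  shows "x i = t * z i"
proof (cases "i \<in> S")
  case False
  then show ?thesis using i xT z_off by simp
next
  case True
  have g0: "g x i = 0" and u0: "u x = 0" for i
    unfolding g_def u_def using xT by (auto intro!: sum.neutral)
  have zg0: "zg x = 0" by (simp add: zg_def g0)
  have h0: "h x i = 0" for i by (simp add: h_def g0 u0 zg0)
  have T1: "(\<Sum>i\<in>T. \<Sum>j\<in>T. x i * A i j * x j) = 0" for A :: "nat \<Rightarrow> nat \<Rightarrow> real"
    by (intro sum.neutral ballI) (simp add: xT)
  have T2: "(\<Sum>i\<in>T. (x i)\<^sup>2) = 0" by (rule sum.neutral) (simp add: xT)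
  have schur0: "schur x = 0" by (simp only: schur_def T1 T2 g0 u0 zg0 h0) simp
  define k where "k = (\<Sum>i\<in>S. y i * x i) / Y11"
  define q where "q = (\<Sum>i\<in>S. (\<delta> * (sh x i - \<beta> x * z i / s))\<^sup>2)"
  have q0: "0 \<le> q" unfolding q_def by (intro sum_nonneg) auto
  have "Y11 * (t + k)\<^sup>2 + q / \<delta> \<le> 0"
    using F_lower_bound[of t x] unfolding F schur0 T1 u0 zg0 h0 by (simp add: k_def q_def)
  moreover have "0 \<le> Y11 * (t + k)\<^sup>2" using Y11_pos by simp
  moreover have "0 \<le> q / \<delta>" using q0 \<delta>_pos by simp
  ultimately have "Y11 * (t + k)\<^sup>2 = 0" and "q / \<delta> = 0" by linarith+
  then have tk: "k = - t" and "q = 0" using Y11_pos \<delta>_pos by auto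
  define c where "c = \<beta> x / s"
  have sh: "sh x j = c * z j" if "j \<in> S" for j
  proof -
    have "(\<delta> * (sh x j - \<beta> x * z j / s))\<^sup>2 = 0"
      using \<open>q = 0\<close> that unfolding q_def by (subst (asm) sum_nonneg_eq_0_iff) auto
    then show ?thesis using \<delta>_pos by (simp add: c_def)
  qed
  have x: "x j = (c + t) * z j" if "j \<in> S" for j
  proof -
    have "sh x j = x j + k * z j" by (simp add: sh_def k_def)
    then show ?thesis using sh[OF that] tk by (simp add: algebra_simps)
  qed
  have "(\<Sum>j\<in>S. y j * x j) = (c + t) * (\<Sum>j\<in>S. y j * z j)"
    unfolding sum_distrib_left by (rule sum.cong) (simp_all add: x)
  then have "k = - (c + t)" using Y11_pos Y11_eq by (simp add: k_def field_simps)
  then have "c = 0" using tk by simp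
  then show ?thesis using x True by simp
qed

section \<open>The program in coordinates and the objective gap\<close>

definition w :: "nat \<Rightarrow> real" where "w a = (case a of 0 \<Rightarrow> 1 | Suc i \<Rightarrow> z i)"

lemma w_simps [simp]: "w 0 = 1" "w (Suc i) = z i" by (simp_all add: w_def)

text \<open>Index 0 is the homogenizing coordinate and \<open>Suc i\<close> is the original index
  \<open>i\<close>. The constant \<open>b \<bullet> b / n\<close>, which comes from the corner of
  \<open>A\<^sup>T A\<close>, is left out.\<close>

definition obj :: "(nat \<Rightarrow> nat \<Rightarrow> real) \<Rightarrow> real" where
  "obj W = 2 * (\<Sum>i<d. y i * W 0 (Suc i)) + (\<Sum>i<d. \<Sum>j<d. G i j * W (Suc i) (Suc j))"

definition feas :: "(nat \<Rightarrow> nat \<Rightarrow> real) \<Rightarrow> bool" where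
  "feas W \<longleftrightarrow> (\<forall>a\<le>d. \<forall>b\<le>d. W a b = W b a) \<and>
     (\<forall>v. 0 \<le> (\<Sum>a\<le>d. \<Sum>b\<le>d. v a * W a b * v b)) \<and> W 0 0 = 1 \<and>
     (\<Sum>i<d. W (Suc i) (Suc i)) = s \<and>
     (\<Sum>i<d. \<Sum>j<d. \<bar>W (Suc i) (Suc j)\<bar>) \<le> s\<^sup>2 \<and> (\<forall>i<d. W (Suc i) (Suc i) \<le> 1)"

text \<open>Both sides are the trace of \<open>Y W\<close>: on the left through a Gram decomposition
  of \<open>W\<close>, on the right split by multipliers.\<close>

lemma form_sum:
  assumes "\<And>a b. a \<le> d \<Longrightarrow> b \<le> d \<Longrightarrow> W a b = (\<Sum>k\<in>K. L k a * L k b)" and "finite K"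
  shows "(\<Sum>k\<in>K. F (L k 0) (\<lambda>i. L k (Suc i)))
    = Y11 * W 0 0 + obj W + (\<Sum>i<d. \<Sum>j<d. R i j * W (Suc i) (Suc j))
      + \<mu>2 * (\<Sum>i<d. W (Suc i) (Suc i)) + (\<Sum>i<d. p i * W (Suc i) (Suc i))"
proof -
  have 1: "(\<Sum>k\<in>K. Y11 * (L k 0)\<^sup>2) = Y11 * W 0 0"
    by (simp add: assms sum_distrib_left power2_eq_square)
  have 2: "(\<Sum>k\<in>K. 2 * L k 0 * (\<Sum>i<d. y i * L k (Suc i))) = 2 * (\<Sum>i<d. y i * W 0 (Suc i))"
  proof -
    have "(\<Sum>k\<in>K. 2 * L k 0 * (\<Sum>i<d. y i * L k (Suc i)))
        = (\<Sum>i<d. \<Sum>k\<in>K. 2 * (y i * (L k 0 * L k (Suc i))))"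
      by (subst sum.swap) (simp add: sum_distrib_left mult_ac)
    also have "\<dots> = (\<Sum>i<d. 2 * (y i * W 0 (Suc i)))"
      by (rule sum.cong) (simp_all add: assms sum_distrib_left)
    finally show ?thesis by (simp add: sum_distrib_left)
  qed
  have 3: "(\<Sum>k\<in>K. \<Sum>i<d. \<Sum>j<d. Yx i j * (L k (Suc i) * L k (Suc j)))
      = (\<Sum>i<d. \<Sum>j<d. Yx i j * W (Suc i) (Suc j))"
    by (subst sum.swap, rule sum.cong, simp, subst sum.swap, rule sum.cong)
      (simp_all add: assms sum_distrib_left)
  have 4: "(\<Sum>j<d. Yx i j * W (Suc i) (Suc j)) = (\<Sum>j<d. G i j * W (Suc i) (Suc j))
      + (\<Sum>j<d. R i j * W (Suc i) (Suc j)) + (\<mu>2 + p i) * W (Suc i) (Suc i)" if "i < d" for i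
  proof -
    have "(\<Sum>j<d. (if i = j then \<mu>2 + p i else 0) * W (Suc i) (Suc j))
        = (\<Sum>j<d. if i = j then (\<mu>2 + p i) * W (Suc i) (Suc j) else 0)"
      by (rule sum.cong) auto
    then have "(\<Sum>j<d. (if i = j then \<mu>2 + p i else 0) * W (Suc i) (Suc j))
        = (\<mu>2 + p i) * W (Suc i) (Suc i)" using that by simp
    then show ?thesis unfolding Yx_def by (simp add: distrib_right sum.distrib)
  qed
  have "(\<Sum>i<d. \<Sum>j<d. Yx i j * W (Suc i) (Suc j))
      = (\<Sum>i<d. (\<Sum>j<d. G i j * W (Suc i) (Suc j)) + (\<Sum>j<d. R i j * W (Suc i) (Suc j))
          + (\<mu>2 * W (Suc i) (Suc i) + p i * W (Suc i) (Suc i)))"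
    by (rule sum.cong) (simp_all add: 4 distrib_right)
  then show ?thesis
    unfolding F_def sum.distrib 1 2 3 by (simp add: obj_def sum.distrib sum_distrib_left)
qed

text \<open>Entries of \<open>z\<close> on \<open>S\<close> have absolute value 1, so the mixed
  blocks are bounded by (E1) and the block off \<open>S\<close> by the bound on \<Theta>2.\<close>

lemma abs_R_le:
  assumes "i < d" "j < d"
  shows "\<bar>R i j\<bar> \<le> \<mu>3"
proof -
  have z1: "\<bar>z i\<bar> = 1" if "i \<in> S" for i
    using z_sq[OF that] by (metis abs_1 abs_mult abs_square_eq_1 power2_eq_square)
  have e: "\<bar>e i\<bar> / s \<le> \<mu>3" if "i < d" "i \<notin> S" for i
    using e_le[OF that] s_pos by (simp only: pos_divide_le_eq mult.commute)
  show ?thesis using assms e \<theta>_le \<mu>3_nonneg by (auto simp: R_def abs_mult z1)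
qed

text \<open>On \<open>S\<close> the bound on \<mu>3 gives
  \<open>\<delta> - lam \<le> e i * z i - s * \<mu>3\<close>, and \<mu>2 is at most
  \<open>\<delta> - lam\<close>.\<close>

lemma p_nonneg: "0 \<le> p i"
  using \<mu>3_le[of i] \<mu>2_le by (cases "i \<in> S") (simp_all add: p_def)

lemma sum_z_sq_all: "(\<Sum>i<d. z i * z i) = s"
  using sum_split[of "\<lambda>i. z i * z i"] z_off by (simp add: sum_z_sq)

text \<open>Complementary slackness of the 1-norm constraint: the matrix from \<open>z\<close> lives
  on \<open>S\<close>, where \<open>R\<close> is \<mu>3 times its sign pattern.\<close>

lemma R_certificate: "(\<Sum>i<d. \<Sum>j<d. R i j * (z i * z j)) = \<mu>3 * s\<^sup>2"
proof -
  have "R i j * (z i * z j) = \<mu>3 * ((z i * z i) * (z j * z j))" if "i < d" "j < d" for i j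
    using that z_off z_sq by (cases "i \<in> S"; cases "j \<in> S") (auto simp: R_def mult_ac)
  then have "(\<Sum>i<d. \<Sum>j<d. R i j * (z i * z j)) = (\<Sum>i<d. \<Sum>j<d. \<mu>3 * ((z i * z i) * (z j * z j)))"
    by (intro sum.cong refl) simp
  also have "\<dots> = \<mu>3 * ((\<Sum>i<d. z i * z i) * (\<Sum>i<d. z i * z i))"
    unfolding sum_product by (simp add: sum_distrib_left)
  finally show ?thesis by (simp add: sum_z_sq_all power2_eq_square)
qed

text \<open>Subtract \<open>form_sum\<close> for the candidate from \<open>form_sum\<close> for
  \<open>W\<close>. The corner and trace terms agree by feasibility, and the form of the candidate
  is 0.\<close>

lemma obj_gap:
  assumes "feas W" and L: "\<And>a b. a \<le> d \<Longrightarrow> b \<le> d \<Longrightarrow> W a b = (\<Sum>k\<in>K. L k a * L k b)" "finite K"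
  shows "obj W = obj (\<lambda>a b. w a * w b) + (\<Sum>k\<in>K. F (L k 0) (\<lambda>i. L k (Suc i)))
    + (\<mu>3 * s\<^sup>2 - (\<Sum>i<d. \<Sum>j<d. R i j * W (Suc i) (Suc j)))
    + (\<Sum>i<d. p i * (1 - W (Suc i) (Suc i)))"
proof -
  have "F 1 z = Y11 + obj (\<lambda>a b. w a * w b) + \<mu>3 * s\<^sup>2 + \<mu>2 * s + (\<Sum>i<d. p i * (z i * z i))"
    \<comment> \<open>The candidate has rank one, so the single Gram vector \<open>w\<close> is
      enough.\<close>
    using form_sum[where W = "\<lambda>a b. w a * w b" and K = "{0 :: nat}" and L = "\<lambda>_. w"]
    by (simp add: R_certificate sum_z_sq_all)
  moreover have "(\<Sum>i<d. p i * (z i * z i)) = (\<Sum>i<d. p i)"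
    by (rule sum.cong) (auto simp: p_def z_sq)
  ultimately show ?thesis
    using form_sum[where W = W and K = K and L = L, OF L] assms(1) unfolding F_certificate
    by (simp add: feas_def right_diff_distrib sum_subtractf)
qed

text \<open>The slack of the 1-norm constraint is reduced to entrywise slacks, each nonnegative, so
  that equality can later be read off entry by entry.\<close>

lemma R_sum_le:
  assumes "feas W"
  shows "(\<Sum>i<d. \<Sum>j<d. \<mu>3 * \<bar>W (Suc i) (Suc j)\<bar> - R i j * W (Suc i) (Suc j))
    \<le> \<mu>3 * s\<^sup>2 - (\<Sum>i<d. \<Sum>j<d. R i j * W (Suc i) (Suc j))"
proof -
  have "\<mu>3 * (\<Sum>i<d. \<Sum>j<d. \<bar>W (Suc i) (Suc j)\<bar>) \<le> \<mu>3 * s\<^sup>2"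
    using assms \<mu>3_nonneg by (intro mult_left_mono) (auto simp: feas_def)
  then show ?thesis by (simp add: sum_subtractf sum_distrib_left)
qed

lemma R_term_nonneg: "i < d \<Longrightarrow> j < d \<Longrightarrow> 0 \<le> \<mu>3 * \<bar>c\<bar> - R i j * c"
proof -
  assume "i < d" "j < d"
  then have "\<bar>R i j\<bar> * \<bar>c\<bar> \<le> \<mu>3 * \<bar>c\<bar>" by (intro mult_right_mono abs_R_le) auto
  then show ?thesis using abs_ge_self[of "R i j * c"] by (simp add: abs_mult)
qed

lemma feas_gram:
  assumes "feas W"
  obtains L where "\<And>a b. a \<le> d \<Longrightarrow> b \<le> d \<Longrightarrow> W a b = (\<Sum>k\<le>d. L k a * L k b :: real)"
  using psd_gram[of "{..d}" W] assms unfolding feas_def by (metis atMost_iff finite_atMost)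

lemma feas_w: "feas (\<lambda>a b. w a * w b)"
proof -
  have z1: "\<bar>z i\<bar> = (if i \<in> S then 1 else 0)" if "i < d" for i
    using z_sq z_off that by (metis abs_1 abs_mult abs_square_eq_1 power2_eq_square abs_0)
  have sz: "(\<Sum>i<d. \<bar>z i\<bar>) = s"
    using z1 S(1) by (simp add: Int_absorb1 flip: sum.inter_restrict)
  have "(\<Sum>a\<le>d. \<Sum>b\<le>d. v a * (w a * w b) * v b) = (\<Sum>a\<le>d. v a * w a)\<^sup>2" for v
    by (simp add: power2_eq_square sum_product mult_ac)
  moreover have "(\<Sum>i<d. \<Sum>j<d. \<bar>z i * z j\<bar>) = s\<^sup>2"
    unfolding power2_eq_square sz[symmetric] sum_product by (simp add: abs_mult)
  moreover have "z i * z i \<le> 1" if "i < d" for i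
    using that z_sq z_off by (cases "i \<in> S") auto
  ultimately show ?thesis by (simp add: feas_def sum_z_sq_all)
qed

section \<open>Optimality and uniqueness\<close>

context
  assumes gap_nonneg: "\<And>x. 0 \<le> schur_gap x"
begin

text \<open>The assumption \<open>gap_nonneg\<close> is positive semidefiniteness of \<Theta>1,
  available in both alternatives of (E2). With it every term of the objective gap has the right
  sign.\<close>

lemma gaps_nonneg:
  assumes "feas W"
  shows "0 \<le> F t x"
    and "0 \<le> (\<Sum>i<d. \<Sum>j<d. \<mu>3 * \<bar>W (Suc i) (Suc j)\<bar> - R i j * W (Suc i) (Suc j))"
    and "0 \<le> (\<Sum>i<d. p i * (1 - W (Suc i) (Suc i)))"
proof -
  show "0 \<le> F t x" using gap_nonneg[of x] schur_gap_le_F[of x t] by linarith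
  show "0 \<le> (\<Sum>i<d. \<Sum>j<d. \<mu>3 * \<bar>W (Suc i) (Suc j)\<bar> - R i j * W (Suc i) (Suc j))"
    by (intro sum_nonneg) (auto simp del: diff_ge_0_iff_ge intro: R_term_nonneg)
  show "0 \<le> (\<Sum>i<d. p i * (1 - W (Suc i) (Suc i)))"
    using assms by (intro sum_nonneg mult_nonneg_nonneg p_nonneg) (auto simp: feas_def)
qed

lemma obj_minimal:
  assumes "feas W"
  shows "obj (\<lambda>a b. w a * w b) \<le> obj W"
proof -
  obtain L where L: "\<And>a b. a \<le> d \<Longrightarrow> b \<le> d \<Longrightarrow> W a b = (\<Sum>k\<le>d. L k a * L k b)"
    using feas_gram[OF assms] by blast
  have "0 \<le> (\<Sum>k\<le>d. F (L k 0) (\<lambda>i. L k (Suc i)))"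
    by (intro sum_nonneg gaps_nonneg(1)[OF assms])
  then show ?thesis
    using obj_gap[OF assms L] R_sum_le[OF assms] gaps_nonneg(2,3)[OF assms] by auto
qed

text \<open>At a minimizer all gap terms are 0, hence so is \<open>F\<close> at each Gram vector.
  Either alternative in \<open>strict\<close> makes these vectors vanish on \<open>T\<close>, and
  then \<open>F_eq_0_imp\<close> makes them multiples of \<open>w\<close>.\<close>

lemma obj_minimizer_unique:
  assumes "feas W" and le: "obj W \<le> obj (\<lambda>a b. w a * w b)"
    and strict: "(\<forall>x. schur_gap x = 0 \<longrightarrow> (\<forall>i\<in>T. x i = 0)) \<or> (\<forall>i\<in>T. \<bar>\<theta> i i\<bar> < \<mu>3)"
    and ab: "a \<le> d" "b \<le> d"
  shows "W a b = w a * w b"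
proof -
  obtain L where L: "\<And>a b. a \<le> d \<Longrightarrow> b \<le> d \<Longrightarrow> W a b = (\<Sum>k\<le>d. L k a * L k b)"
    using feas_gram[OF assms(1)] by blast
  let ?F = "\<lambda>k. F (L k 0) (\<lambda>i. L k (Suc i))"
  have F0: "0 \<le> (\<Sum>k\<le>d. ?F k)" by (intro sum_nonneg gaps_nonneg(1)[OF assms(1)])
  have Fz: "(\<Sum>k\<le>d. ?F k) = 0"
    and Rz: "(\<Sum>i<d. \<Sum>j<d. \<mu>3 * \<bar>W (Suc i) (Suc j)\<bar> - R i j * W (Suc i) (Suc j)) = 0"
    using le F0 obj_gap[OF assms(1) L] R_sum_le[OF assms(1)] gaps_nonneg(2,3)[OF assms(1)] by auto
  have Fk: "?F k = 0" if "k \<le> d" for k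
    using Fz that by (subst (asm) sum_nonneg_eq_0_iff) (auto intro: gaps_nonneg(1)[OF assms(1)])
  have xT: "L k (Suc i) = 0" if k: "k \<le> d" and i: "i \<in> T" for k i
    using strict
  proof
    assume "\<forall>x. schur_gap x = 0 \<longrightarrow> (\<forall>i\<in>T. x i = 0)"
    moreover have "schur_gap (\<lambda>i. L k (Suc i)) = 0"
      using gap_nonneg[of "\<lambda>i. L k (Suc i)"] schur_gap_le_F[of "\<lambda>i. L k (Suc i)" "L k 0"] Fk[OF k]
      by simp
    ultimately show ?thesis using i by blast
  next
    assume th: "\<forall>i\<in>T. \<bar>\<theta> i i\<bar> < \<mu>3"
    have id: "i < d" "i \<notin> S" using i by auto
    \<comment> \<open>The vanishing double sum is localized first to row \<open>i\<close>, then to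
      its diagonal entry. There \<open>R i i\<close> is \<open>- \<theta> i i\<close>, strictly
      below \<mu>3 in absolute value, so the diagonal entry of \<open>W\<close>, a sum of squares,
      must be 0.\<close>
    have "(\<Sum>j<d. \<mu>3 * \<bar>W (Suc i) (Suc j)\<bar> - R i j * W (Suc i) (Suc j)) = 0"
      using Rz id R_term_nonneg
      by (subst (asm) sum_nonneg_eq_0_iff) (auto simp del: diff_ge_0_iff_ge intro!: sum_nonneg)
    then have "\<mu>3 * \<bar>W (Suc i) (Suc i)\<bar> - R i i * W (Suc i) (Suc i) = 0"
      using id R_term_nonneg
      by (subst (asm) sum_nonneg_eq_0_iff) (auto simp del: diff_ge_0_iff_ge)
    then have eq: "\<mu>3 * \<bar>W (Suc i) (Suc i)\<bar> = - \<theta> i i * W (Suc i) (Suc i)"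
      using id by (simp add: R_def)
    have "W (Suc i) (Suc i) = 0"
    proof (rule ccontr)
      assume "W (Suc i) (Suc i) \<noteq> 0"
      then have "\<bar>\<theta> i i\<bar> * \<bar>W (Suc i) (Suc i)\<bar> < \<mu>3 * \<bar>W (Suc i) (Suc i)\<bar>"
        using th i by (intro mult_strict_right_mono) auto
      moreover have "- \<theta> i i * W (Suc i) (Suc i) \<le> \<bar>\<theta> i i\<bar> * \<bar>W (Suc i) (Suc i)\<bar>"
        by (metis abs_ge_self abs_minus_cancel abs_mult)
      ultimately show False using eq by linarith
    qed
    then have "(\<Sum>k\<le>d. L k (Suc i) * L k (Suc i)) = 0" using L[of "Suc i" "Suc i"] id by simp
    then show ?thesis using k by (subst (asm) sum_nonneg_eq_0_iff) auto
  qed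
  have Lw: "L k a = L k 0 * w a" if "k \<le> d" "a \<le> d" for k a
    using that F_eq_0_imp[OF Fk xT] by (cases a) auto
  have "W a b = (\<Sum>k\<le>d. L k 0 * L k 0) * (w a * w b)"
    unfolding L[OF ab] sum_distrib_right
    by (rule sum.cong) (use ab in \<open>simp_all add: Lw[of _ a] Lw[of _ b] mult_ac\<close>)
  also have "(\<Sum>k\<le>d. L k 0 * L k 0) = 1" using L[of 0 0] assms(1) by (simp add: feas_def)
  finally show ?thesis by simp
qed

end

end

subsection \<open>Translation to matrices\<close>

lemma sum_pick:
  fixes f :: "nat \<Rightarrow> 'b :: comm_monoid_add"
  assumes "finite I"
  shows "(\<Sum>i<card I. f (pick I i)) = (\<Sum>i\<in>I. f i)"
proof (rule sum.reindex_bij_witness[where i = "\<lambda>i. card {a\<in>I. a < i}" and j = "pick I"])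
  show "card {a\<in>I. a < i} \<in> {..<card I}" if "i \<in> I" for i
    using assms that psubset_card_mono[of I "{a\<in>I. a < i}"] by auto
qed (auto simp: card_pick_le pick_in_set_le pick_card_in_set)

lemma subvec_index:
  assumes "v \<in> carrier_vec d" "I \<subseteq> {0..<d}" "i < card I"
  shows "subvec v I $ i = v $ pick I i"
proof -
  have "{i. i < d \<and> i \<in> I} = I" using assms by auto
  then show ?thesis using assms by (simp add: subvec_def)
qed

lemma submatrix_index_pick:
  assumes "A \<in> carrier_mat d d" "I \<subseteq> {0..<d}" "J \<subseteq> {0..<d}" "i < card I" "j < card J"
  shows "submatrix A I J $$ (i, j) = A $$ (pick I i, pick J j)"
proof -
  have "{i. i < d \<and> i \<in> I} = I" "{i. i < d \<and> i \<in> J} = J" using assms by auto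
  then show ?thesis using assms by (simp add: submatrix_index)
qed

text \<open>The bridge between compressed vectors and functions on the original indices, used for
  every block quantity below.\<close>

lemma scalar_prod_pick:
  fixes v w :: "real vec"
  assumes "finite I" "w \<in> carrier_vec (card I)"
    and "\<And>i. i < card I \<Longrightarrow> v $ i = f (pick I i)" "\<And>i. i < card I \<Longrightarrow> w $ i = k (pick I i)"
  shows "v \<bullet> w = (\<Sum>i\<in>I. f i * k i)"
  unfolding sum_pick[OF assms(1), symmetric]
  using assms by (simp add: scalar_prod_def atLeast0LessThan)

lemma submatrix_mult_vec_pick:
  fixes A :: "real mat"
  assumes "A \<in> carrier_mat d d" "I \<subseteq> {0..<d}" "J \<subseteq> {0..<d}" "v \<in> carrier_vec (card J)"
    and "\<And>i. i < card J \<Longrightarrow> v $ i = f (pick J i)" and "i < card I"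
  shows "(submatrix A I J *\<^sub>v v) $ i = (\<Sum>j\<in>J. A $$ (pick I i, j) * f j)"
proof -
  have fin: "finite J" using assms(3) finite_subset by auto
  have "submatrix A I J \<in> carrier_mat (card I) (card J)"
    by (rule submatrix_carrier) (use assms in auto)
  then have "(submatrix A I J *\<^sub>v v) $ i = row (submatrix A I J) i \<bullet> v" using assms(6) by simp
  also have "\<dots> = (\<Sum>j\<in>J. A $$ (pick I i, j) * f j)"
    by (rule scalar_prod_pick)
      (use assms fin \<open>submatrix A I J \<in> carrier_mat (card I) (card J)\<close> in
        \<open>auto simp: submatrix_index_pick\<close>)
  finally show ?thesis .
qed

lemma abs_le_vec_norm_inf:
  assumes "i < dim_vec v" shows "\<bar>v $ i\<bar> \<le> vec_norm_inf v"
  unfolding vec_norm_inf_def using assms by (intro Max_ge) auto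

lemma vec_norm_inf_nonneg: "0 \<le> vec_norm_inf v"
  unfolding vec_norm_inf_def by (intro Max_ge) auto

lemma abs_le_mat_norm_inf:
  assumes "A \<in> carrier_mat k l" "i < k" "j < l" shows "\<bar>A $$ (i, j)\<bar> \<le> mat_norm_inf A"
proof -
  have "finite (elements_mat A)" unfolding elements_mat_def by (rule finite_set)
  then show ?thesis
    unfolding mat_norm_inf_def using elements_matI[OF assms refl] by (intro Max_ge) auto
qed

section \<open>Feasibility and objective as coordinate sums\<close>

lemma pos_semidef_iff_sum:
  "pos_semidef k W \<longleftrightarrow> W \<in> carrier_mat k k \<and> (\<forall>a<k. \<forall>b<k. W $$ (a, b) = W $$ (b, a)) \<and>
    (\<forall>v. 0 \<le> (\<Sum>a<k. \<Sum>b<k. v a * W $$ (a, b) * v b))"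
proof (cases "W \<in> carrier_mat k k")
  case True
  have sym: "transpose_mat W = W \<longleftrightarrow> (\<forall>a<k. \<forall>b<k. W $$ (a, b) = W $$ (b, a))"
  proof
    assume W: "transpose_mat W = W"
    show "\<forall>a<k. \<forall>b<k. W $$ (a, b) = W $$ (b, a)"
    proof (intro allI impI)
      fix a b assume "a < k" "b < k"
      then show "W $$ (a, b) = W $$ (b, a)"
        using True arg_cong[OF W, of "\<lambda>B. B $$ (a, b)"] by simp
    qed
  qed (use True in \<open>auto intro!: eq_matI\<close>)
  have "(\<forall>v\<in>carrier_vec k. 0 \<le> v \<bullet> (W *\<^sub>v v)) \<longleftrightarrow>
      (\<forall>v. 0 \<le> (\<Sum>a<k. \<Sum>b<k. v a * W $$ (a, b) * v b))" (is "?l \<longleftrightarrow> ?r")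
  proof
    assume ?l
    show ?r
    proof
      fix v :: "nat \<Rightarrow> real"
      have "0 \<le> vec k v \<bullet> (W *\<^sub>v vec k v)" using \<open>?l\<close> by simp
      then show "0 \<le> (\<Sum>a<k. \<Sum>b<k. v a * W $$ (a, b) * v b)"
        unfolding quad_form_sum[OF True vec_carrier vec_carrier] by simp
    qed
  next
    assume ?r
    then show ?l using quad_form_sum[OF True] by simp
  qed
  then show ?thesis using sym by (simp add: pos_semidef_def True)
qed (simp add: pos_semidef_def)

lemma sils_feasible_iff:
  "sils_feasible d \<sigma> W \<longleftrightarrow> W \<in> carrier_mat (Suc d) (Suc d) \<and>
    (\<forall>a\<le>d. \<forall>b\<le>d. W $$ (a, b) = W $$ (b, a)) \<and>
    (\<forall>v. 0 \<le> (\<Sum>a\<le>d. \<Sum>b\<le>d. v a * W $$ (a, b) * v b)) \<and> W $$ (0, 0) = 1 \<and>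
    (\<Sum>i<d. W $$ (Suc i, Suc i)) = real \<sigma> \<and>
    (\<Sum>i<d. \<Sum>j<d. \<bar>W $$ (Suc i, Suc j)\<bar>) \<le> (real \<sigma>)\<^sup>2 \<and>
    (\<forall>i<d. W $$ (Suc i, Suc i) \<le> 1)"
proof (cases "W \<in> carrier_mat (Suc d) (Suc d)")
  case True
  have del: "mat_delete W 0 0 $$ (i, j) = W $$ (Suc i, Suc j)" if "i < d" "j < d" for i j
    using True that by (simp add: mat_delete_def)
  have car: "mat_delete W 0 0 \<in> carrier_mat d d" using mat_delete_carrier[OF True] by simp
  have tr: "mat_trace (mat_delete W 0 0) = (\<Sum>i<d. W $$ (Suc i, Suc i))"
    unfolding mat_trace_def carrier_matD(1)[OF car] by (rule sum.cong) (simp_all add: del)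
  have "ones_vec d \<in> carrier_vec d" by (simp add: ones_vec_def)
  then have "ones_vec d \<bullet> (map_mat abs (mat_delete W 0 0) *\<^sub>v ones_vec d)
      = (\<Sum>i<d. \<Sum>j<d. \<bar>W $$ (Suc i, Suc j)\<bar>)"
    using quad_form_sum[of "map_mat abs (mat_delete W 0 0)" d d "ones_vec d" "ones_vec d"] car True
    by (simp add: ones_vec_def del)
  then show ?thesis
    unfolding sils_feasible_def Let_def tr
    by (simp add: pos_semidef_iff_sum del True less_Suc_eq_le lessThan_Suc_atMost)
qed (simp add: sils_feasible_def pos_semidef_def)

lemma sils_A_index:
  assumes "M \<in> carrier_mat n d" "b \<in> carrier_vec n"
  shows "sils_A n M b \<in> carrier_mat n (Suc d)"
    and "r < n \<Longrightarrow> sils_A n M b $$ (r, 0) = - b $ r"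
    and "r < n \<Longrightarrow> j < d \<Longrightarrow> sils_A n M b $$ (r, Suc j) = M $$ (r, j)"
  using assms by (auto simp: sils_A_def mat_of_cols_index)

text \<open>Symmetry of \<open>W\<close> turns the trace into an entrywise product; the row and
  column of index 0 then give the constant and twice the linear term.\<close>

lemma sils_objective_eq:
  assumes M: "M \<in> carrier_mat n d" and b: "b \<in> carrier_vec n"
    and W: "W \<in> carrier_mat (Suc d) (Suc d)" and sym: "\<forall>a\<le>d. \<forall>b\<le>d. W $$ (a, b) = W $$ (b, a)"
    and W00: "W $$ (0, 0) = 1"
  shows "sils_objective n M b W = (b \<bullet> b) / real n
    + (2 * (\<Sum>i<d. - ((transpose_mat M *\<^sub>v b) $ i / real n) * W $$ (0, Suc i))
      + (\<Sum>i<d. \<Sum>j<d. (transpose_mat M * M) $$ (i, j) / real n * W $$ (Suc i, Suc j)))"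
proof -
  let ?A = "sils_A n M b"
  note A = sils_A_index[OF M b]
  define C where "C = transpose_mat ?A * ?A"
  have C: "C \<in> carrier_mat (Suc d) (Suc d)" unfolding C_def using A(1) by simp
  have C_index: "C $$ (a, c) = (\<Sum>r<n. ?A $$ (r, a) * ?A $$ (r, c))" if "a < Suc d" "c < Suc d" for a c
    unfolding C_def using A(1) that by (simp add: scalar_prod_def atLeast0LessThan)
  have C00: "C $$ (0, 0) = b \<bullet> b"
    using b by (simp add: C_index A scalar_prod_def atLeast0LessThan)
  have C0: "C $$ (0, Suc i) = - (transpose_mat M *\<^sub>v b) $ i"
    and C0': "C $$ (Suc i, 0) = - (transpose_mat M *\<^sub>v b) $ i" if "i < d" for i
    using that b M by (simp_all add: C_index A scalar_prod_def atLeast0LessThan sum_negf mult.commute)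
  have CS: "C $$ (Suc i, Suc j) = (transpose_mat M * M) $$ (i, j)" if "i < d" "j < d" for i j
    using that M by (simp add: C_index A scalar_prod_def atLeast0LessThan)
  have trC: "mat_trace (C * W) = b \<bullet> b + 2 * (\<Sum>i<d. - (transpose_mat M *\<^sub>v b) $ i * W $$ (0, Suc i))
      + (\<Sum>i<d. \<Sum>j<d. (transpose_mat M * M) $$ (i, j) * W $$ (Suc i, Suc j))"
  proof -
    have "mat_trace (C * W) = (\<Sum>a<Suc d. \<Sum>c<Suc d. C $$ (a, c) * W $$ (c, a))"
      using C W by (simp add: mat_trace_def scalar_prod_def atLeast0LessThan)
    also have "\<dots> = (\<Sum>a<Suc d. \<Sum>c<Suc d. C $$ (a, c) * W $$ (a, c))"
      using sym by (intro sum.cong refl) (auto simp: less_Suc_eq_le)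
    also have "\<dots> = b \<bullet> b + 2 * (\<Sum>i<d. - (transpose_mat M *\<^sub>v b) $ i * W $$ (0, Suc i))
        + (\<Sum>i<d. \<Sum>j<d. (transpose_mat M * M) $$ (i, j) * W $$ (Suc i, Suc j))"
      unfolding sum.lessThan_Suc_shift sum.distrib
      using sym by (simp add: C00 C0 C0' CS W00)
    finally show ?thesis .
  qed
  have "(\<Sum>i<d. - ((transpose_mat M *\<^sub>v b) $ i / real n) * W $$ (0, Suc i))
      = (\<Sum>i<d. - (transpose_mat M *\<^sub>v b) $ i * W $$ (0, Suc i)) / real n"
    unfolding sum_divide_distrib by (rule sum.cong) simp_all
  moreover have "(\<Sum>i<d. \<Sum>j<d. (transpose_mat M * M) $$ (i, j) / real n * W $$ (Suc i, Suc j))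
      = (\<Sum>i<d. \<Sum>j<d. (transpose_mat M * M) $$ (i, j) * W $$ (Suc i, Suc j)) / real n"
    by (simp add: sum_divide_distrib)
  ultimately show ?thesis
    unfolding sils_objective_def C_def[symmetric] trC by (simp add: add_divide_distrib)
qed

theorem theorem8:
  fixes n d \<sigma> :: nat
    and M :: "real mat"
    and b \<epsilon> z y yS zS :: "real Matrix.vec"
    and S :: "nat set"
    and Y11 :: real
  assumes "0 < n" and "0 < d" and "0 < \<sigma>" and "\<sigma> \<le> d"
    and "M \<in> carrier_mat n d" and "\<epsilon> \<in> carrier_vec n"
    and "z \<in> sign_vecs d" and "card (vec_supp z) = \<sigma>"
    and "b = M *\<^sub>v z + \<epsilon>"
    and "S = vec_supp z"
    and "y = - ((1 / real n) \<cdot>\<^sub>v (transpose_mat M *\<^sub>v b))"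
    and "yS = subvec y S" and "zS = subvec z S"
    and "Y11 = - (scalar_prod yS zS)"
    and "Y11 > 0"
    and "\<exists>\<delta>>0.
      1 / (real n * real \<sigma>) * vec_norm_inf (subvec (transpose_mat M *\<^sub>v \<epsilon>) ({0..<d} - S))
        \<le> mu3_star n \<sigma> S M \<epsilon> z \<delta> \<and>
      (\<exists>\<mu>2 \<le> - lambda_min ((1 / real n) \<cdot>\<^sub>m submatrix (transpose_mat M * M) S S) + \<delta>.
        \<exists>\<Theta>1 \<in> carrier_mat (d - \<sigma>) (d - \<sigma>). \<exists>\<Theta>2 \<in> carrier_mat (d - \<sigma>) (d - \<sigma>).
          Theta_mat n d \<sigma> S M \<epsilon> yS zS Y11 \<delta> \<mu>2 = \<Theta>1 + \<Theta>2 \<and>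
          (pos_def (d - \<sigma>) \<Theta>1 \<and> mat_norm_inf \<Theta>2 \<le> mu3_star n \<sigma> S M \<epsilon> z \<delta> \<or>
           pos_semidef (d - \<sigma>) \<Theta>1 \<and> mat_norm_inf \<Theta>2 < mu3_star n \<sigma> S M \<epsilon> z \<delta>))"
  shows "sils_recovers n d \<sigma> M b z"
proof -
  note n = \<open>0 < n\<close> and \<sigma> = \<open>0 < \<sigma>\<close> and M = \<open>M \<in> carrier_mat n d\<close> and eps = \<open>\<epsilon> \<in> carrier_vec n\<close>
    and S_def = \<open>S = vec_supp z\<close> and b_def = \<open>b = M *\<^sub>v z + \<epsilon>\<close>
    and y_def = \<open>y = - ((1 / real n) \<cdot>\<^sub>v (transpose_mat M *\<^sub>v b))\<close>
  have z: "z \<in> carrier_vec d" and z_val: "\<And>i. i < d \<Longrightarrow> z $ i \<in> {0, 1, -1}"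
    using \<open>z \<in> sign_vecs d\<close> by (auto simp: sign_vecs_def)
  have b: "b \<in> carrier_vec n" using M z eps by (simp add: b_def)
  define MM where "MM = transpose_mat M * M"
  define me where "me = transpose_mat M *\<^sub>v \<epsilon>"
  define Sc where "Sc = {0..<d} - S"
  have MM: "MM \<in> carrier_mat d d" using M by (simp add: MM_def)
  have MM_sym: "transpose_mat MM = MM" unfolding MM_def using M by (simp add: transpose_mult[of _ d n _ d])
  have me: "me \<in> carrier_vec d" unfolding me_def using M eps by simp
  have y: "y \<in> carrier_vec d" unfolding y_def using M b by simp
  have S_sub: "S \<subseteq> {0..<d}" using z by (auto simp: S_def vec_supp_def)
  have Sc_sub: "Sc \<subseteq> {0..<d}" by (auto simp: Sc_def)
  have fS: "finite S" and fSc: "finite Sc" using S_sub by (auto simp: Sc_def intro: finite_subset)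
  have cS: "card S = \<sigma>" using \<open>card (vec_supp z) = \<sigma>\<close> by (simp add: S_def)
  have cSc: "card Sc = d - \<sigma>" using S_sub fS cS by (simp add: Sc_def card_Diff_subset)
  have S_iff: "i \<in> S \<longleftrightarrow> i < d \<and> z $ i \<noteq> 0" for i using z by (auto simp: S_def vec_supp_def)
  have T_eq: "{..<d} - S = Sc" by (auto simp: Sc_def)
  have z_sq: "z $ i * z $ i = 1" if "i \<in> S" for i using that z_val[of i] by (auto simp: S_iff)
  from assms(16) obtain \<delta> \<mu>2 \<Theta>1 \<Theta>2 where \<delta>: "0 < \<delta>"
    and E1: "1 / (real n * real \<sigma>) * vec_norm_inf (subvec me Sc) \<le> mu3_star n \<sigma> S M \<epsilon> z \<delta>"
    and \<mu>2: "\<mu>2 \<le> - lambda_min ((1 / real n) \<cdot>\<^sub>m submatrix MM S S) + \<delta>"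
    and \<Theta>1: "\<Theta>1 \<in> carrier_mat (d - \<sigma>) (d - \<sigma>)" and \<Theta>2: "\<Theta>2 \<in> carrier_mat (d - \<sigma>) (d - \<sigma>)"
    and \<Theta>: "Theta_mat n d \<sigma> S M \<epsilon> yS zS Y11 \<delta> \<mu>2 = \<Theta>1 + \<Theta>2"
    and cases: "pos_def (d - \<sigma>) \<Theta>1 \<and> mat_norm_inf \<Theta>2 \<le> mu3_star n \<sigma> S M \<epsilon> z \<delta> \<or>
      pos_semidef (d - \<sigma>) \<Theta>1 \<and> mat_norm_inf \<Theta>2 < mu3_star n \<sigma> S M \<epsilon> z \<delta>"
    unfolding me_def MM_def Sc_def by blast
  define \<mu>3 where "\<mu>3 = mu3_star n \<sigma> S M \<epsilon> z \<delta>"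
  define G where "G i j = MM $$ (i, j) / real n" for i j
  define e where "e i = me $ i / real n" for i
  \<comment> \<open>The position of \<open>i\<close> in the increasing enumeration of
    \<open>Sc\<close>, inverse to \<open>pick Sc\<close>. It transports \<Theta>2 to the original
    indices.\<close>
  define rank where "rank i = card {a\<in>Sc. a < i}" for i
  define \<theta> where "\<theta> i j = \<Theta>2 $$ (rank i, rank j)" for i j
  define lam where "lam = lambda_min ((1 / real n) \<cdot>\<^sub>m submatrix MM S S)"
  have rank: "rank i < d - \<sigma>" if "i \<in> Sc" for i
    unfolding rank_def cSc[symmetric] using fSc that by (intro psubset_card_mono) auto
  have \<theta>_le: "\<bar>\<theta> i j\<bar> \<le> mat_norm_inf \<Theta>2" if "i \<in> Sc" "j \<in> Sc" for i j
    unfolding \<theta>_def using abs_le_mat_norm_inf[OF \<Theta>2 rank rank] that by simp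
  have nonneg1: "0 \<le> c \<bullet> (\<Theta>1 *\<^sub>v c)" if "c \<in> carrier_vec (d - \<sigma>)" for c
    using cases
  proof
    assume "pos_def (d - \<sigma>) \<Theta>1 \<and> mat_norm_inf \<Theta>2 \<le> mu3_star n \<sigma> S M \<epsilon> z \<delta>"
    then show ?thesis
      using that \<Theta>1 by (cases "c = 0\<^sub>v (d - \<sigma>)") (auto simp: pos_def_def less_imp_le)
  qed (use that in \<open>auto simp: pos_semidef_def\<close>)
  have mu3_sigma: "real \<sigma> * \<mu>3 = lam - \<delta> + Min ((\<lambda>i. ((1 / real n) \<cdot>\<^sub>v me) $ i / z $ i) ` S)"
    unfolding \<mu>3_def mu3_star_def lam_def MM_def me_def using \<sigma> by simp
  have SS: "submatrix MM S S \<in> carrier_mat \<sigma> \<sigma>" using submatrix_carrier[OF MM S_sub S_sub] cS by simp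
  interpret C: sils_certificate d S G \<theta> "($) z" e "($) y" Y11 \<delta> lam \<mu>2 \<mu>3
  proof
    show "S \<subseteq> {..<d}" using S_sub by auto
    show "S \<noteq> {}" using cS \<sigma> by auto
    show "G i j = G j i" if "i < d" "j < d" for i j
      using arg_cong[OF MM_sym, of "\<lambda>B. B $$ (i, j)"] that MM by (simp add: G_def)
    show "z $ i * z $ i = 1" if "i \<in> S" for i using z_sq that .
    show "z $ i = 0" if "i < d" "i \<notin> S" for i using that by (simp add: S_iff)
    show "y $ i = - (\<Sum>j\<in>S. G i j * z $ j) - e i" if i: "i < d" for i
    proof -
      have "transpose_mat M *\<^sub>v b = MM *\<^sub>v z + me"
        unfolding b_def MM_def me_def using M z eps
        by (simp add: mult_add_distrib_mat_vec[of _ d n] assoc_mult_mat_vec[of _ d n _ d])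
      then have "y $ i = - (((\<Sum>j<d. MM $$ (i, j) * z $ j) + me $ i) / real n)"
        unfolding y_def using MM me z i by (simp add: scalar_prod_def atLeast0LessThan)
      also have "(\<Sum>j<d. MM $$ (i, j) * z $ j) = (\<Sum>j\<in>S. MM $$ (i, j) * z $ j)"
        by (rule sum.mono_neutral_right) (use S_sub in \<open>auto simp: S_iff\<close>)
      finally show ?thesis
        by (simp add: G_def e_def add_divide_distrib sum_divide_distrib diff_divide_distrib)
    qed
    have "yS \<bullet> zS = (\<Sum>i\<in>S. y $ i * z $ i)"
      unfolding \<open>yS = subvec y S\<close> \<open>zS = subvec z S\<close>
      by (rule scalar_prod_pick[OF fS])
        (use subvec_carrier[OF z S_sub] subvec_index[OF z S_sub] subvec_index[OF y S_sub] in auto)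
    then show "Y11 = - (\<Sum>i\<in>S. y $ i * z $ i)" using \<open>Y11 = - (yS \<bullet> zS)\<close> by simp
    show "0 < Y11" by fact
    show "0 < \<delta>" by fact
    show "lam * (\<Sum>i\<in>S. (v i)\<^sup>2) \<le> (\<Sum>i\<in>S. \<Sum>j\<in>S. v i * G i j * v j)" for v
    proof -
      define w where "w = vec \<sigma> (\<lambda>i. v (pick S i))"
      have w: "w \<in> carrier_vec \<sigma>" and wi: "\<And>i. i < card S \<Longrightarrow> w $ i = v (pick S i)"
        using cS by (simp_all add: w_def)
      have sym: "transpose_mat ((1 / real n) \<cdot>\<^sub>m submatrix MM S S) = (1 / real n) \<cdot>\<^sub>m submatrix MM S S"
      proof -
        have "transpose_mat ((1 / real n) \<cdot>\<^sub>m submatrix MM S S) = (1 / real n) \<cdot>\<^sub>m transpose_mat (submatrix MM S S)"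
          by (intro eq_matI) auto
        then show ?thesis by (simp add: transpose_submatrix MM_sym)
      qed
      have form: "w \<bullet> (((1 / real n) \<cdot>\<^sub>m submatrix MM S S) *\<^sub>v w) = (\<Sum>i\<in>S. v i * (\<Sum>j\<in>S. G i j * v j))"
      proof (rule scalar_prod_pick[OF fS])
        show "(((1 / real n) \<cdot>\<^sub>m submatrix MM S S) *\<^sub>v w) $ i = (\<Sum>j\<in>S. G (pick S i) j * v j)"
          if "i < card S" for i
          using submatrix_mult_vec_pick[OF MM S_sub S_sub _ wi that] w SS that cS
          by (simp add: smult_mat_mult_vec[of _ \<sigma> \<sigma>] G_def sum_divide_distrib)
      qed (use w wi SS cS in \<open>auto intro!: mult_mat_vec_carrier smult_carrier_mat\<close>)
      have "w \<bullet> w = (\<Sum>i\<in>S. v i * v i)"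
        by (rule scalar_prod_pick[OF fS]) (use w wi cS in auto)
      then show ?thesis
        using lambda_min_le_form[OF smult_carrier_mat[OF SS] sym w] form
        by (simp add: lam_def power2_eq_square sum_distrib_left mult.assoc)
    qed
    show "real (card S) * \<mu>3 \<le> lam - \<delta> + e i * z $ i" if i: "i \<in> S" for i
    proof -
      have "Min ((\<lambda>i. ((1 / real n) \<cdot>\<^sub>v me) $ i / z $ i) ` S) \<le> ((1 / real n) \<cdot>\<^sub>v me) $ i / z $ i"
        using fS i by simp
      also have "\<dots> = e i * z $ i"
        using i z_val[of i] me by (auto simp: S_iff e_def)
      finally show ?thesis using mu3_sigma cS by simp
    qed
    \<comment> \<open>(E1) bounds \<mu>3 below by a scaled norm, which is nonnegative even on an
      empty index set.\<close>
    show "0 \<le> \<mu>3"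
      by (rule order_trans[OF _ E1[folded \<mu>3_def]]) (simp add: vec_norm_inf_nonneg)
    show "\<mu>2 \<le> \<delta> - lam" using \<mu>2 by (simp add: lam_def)
    show "\<bar>e i\<bar> \<le> real (card S) * \<mu>3" if "i < d" "i \<notin> S" for i
    proof -
      have i: "i \<in> Sc" using that by (simp add: Sc_def)
      have "subvec me Sc $ rank i = me $ i"
        using subvec_index[OF me Sc_sub] rank[OF i] cSc pick_card_in_set[OF i] by (simp add: rank_def)
      moreover have "rank i < dim_vec (subvec me Sc)"
        using subvec_carrier[OF me Sc_sub] rank[OF i] cSc by simp
      ultimately have "\<bar>me $ i\<bar> \<le> vec_norm_inf (subvec me Sc)" using abs_le_vec_norm_inf by metis
      also have "\<dots> \<le> \<mu>3 * (real n * real \<sigma>)"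
        using E1 n \<sigma> by (simp add: \<mu>3_def field_simps)
      finally show ?thesis using n cS by (simp add: e_def field_simps)
    qed
    show "\<bar>\<theta> i j\<bar> \<le> \<mu>3" if "i < d" "i \<notin> S" "j < d" "j \<notin> S" for i j
      using \<theta>_le[of i j] cases that by (auto simp: Sc_def \<mu>3_def)
  qed
  \<comment> \<open>The restriction of \<open>x\<close> to \<open>Sc\<close>, compressed to a vector
    \<open>c\<close>, turns each part of \<open>C.schur\<close> into the matching term of
    \<open>Theta_mat_form\<close>; subtracting the form of \<Theta>2 leaves that of
    \<Theta>1.\<close>
  have gap: "C.schur_gap x = vec (d - \<sigma>) (\<lambda>i. x (pick Sc i)) \<bullet> (\<Theta>1 *\<^sub>v vec (d - \<sigma>) (\<lambda>i. x (pick Sc i)))" for x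
  proof -
    define c where "c = vec (d - \<sigma>) (\<lambda>i. x (pick Sc i))"
    have c: "c \<in> carrier_vec (d - \<sigma>)" and ci: "\<And>i. i < card Sc \<Longrightarrow> c $ i = x (pick Sc i)"
      using cSc by (simp_all add: c_def)
    have c': "c \<in> carrier_vec (card Sc)" using c cSc by simp
    define g where "g = (1 / real n) \<cdot>\<^sub>v (submatrix MM S Sc *\<^sub>v c)"
    define u where "u = subvec me Sc \<bullet> c / real n"
    define h where "h = g + ((zS \<bullet> g + u) / Y11) \<cdot>\<^sub>v yS"
    have zS: "zS \<in> carrier_vec \<sigma>" and zSi: "\<And>i. i < card S \<Longrightarrow> zS $ i = z $ pick S i"
      using subvec_carrier[OF z S_sub] subvec_index[OF z S_sub] cS \<open>zS = subvec z S\<close> by auto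
    have yS: "yS \<in> carrier_vec \<sigma>" and ySi: "\<And>i. i < card S \<Longrightarrow> yS $ i = y $ pick S i"
      using subvec_carrier[OF y S_sub] subvec_index[OF y S_sub] cS \<open>yS = subvec y S\<close> by auto
    have SSc: "submatrix MM S Sc \<in> carrier_mat \<sigma> (d - \<sigma>)"
      using submatrix_carrier[OF MM S_sub Sc_sub] cS cSc by simp
    have ScSc: "submatrix MM Sc Sc \<in> carrier_mat (d - \<sigma>) (d - \<sigma>)"
      using submatrix_carrier[OF MM Sc_sub Sc_sub] cSc by simp
    have g: "g \<in> carrier_vec \<sigma>" unfolding g_def using SSc c by simp
    have h: "h \<in> carrier_vec \<sigma>" unfolding h_def using g yS by simp
    have gi: "g $ i = C.g x (pick S i)" if "i < card S" for i
      using submatrix_mult_vec_pick[OF MM S_sub Sc_sub c' ci that] SSc that cS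
      by (simp add: g_def C.g_def G_def T_eq sum_divide_distrib)
    have u: "u = C.u x"
    proof -
      have "subvec me Sc \<bullet> c = (\<Sum>i\<in>Sc. me $ i * x i)"
        by (rule scalar_prod_pick[OF fSc c']) (use subvec_index[OF me Sc_sub] ci in auto)
      then show ?thesis by (simp add: u_def C.u_def e_def T_eq sum_divide_distrib)
    qed
    have zg: "zS \<bullet> g = C.zg x"
      unfolding C.zg_def by (rule scalar_prod_pick[OF fS]) (use g gi zSi cS in auto)
    have hi: "h $ i = C.h x (pick S i)" if "i < card S" for i
      using that g yS cS by (simp add: h_def C.h_def gi ySi zg u)
    have zh: "zS \<bullet> h = - C.u x"
      unfolding C.sum_z_h[symmetric] by (rule scalar_prod_pick[OF fS]) (use h hi zSi cS in auto)
    have hh: "h \<bullet> h = (\<Sum>i\<in>S. (C.h x i)\<^sup>2)"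
      unfolding power2_eq_square by (rule scalar_prod_pick[OF fS]) (use h hi cS in auto)
    have cc: "c \<bullet> c = (\<Sum>i\<in>Sc. (x i)\<^sup>2)"
      unfolding power2_eq_square by (rule scalar_prod_pick[OF fSc]) (use c' ci in auto)
    have cGc: "c \<bullet> (submatrix MM Sc Sc *\<^sub>v c) / real n = (\<Sum>i\<in>Sc. \<Sum>j\<in>Sc. x i * G i j * x j)"
    proof -
      have "c \<bullet> (submatrix MM Sc Sc *\<^sub>v c) = (\<Sum>i\<in>Sc. x i * (\<Sum>j\<in>Sc. MM $$ (i, j) * x j))"
        by (rule scalar_prod_pick[OF fSc])
          (use ci ScSc c cSc submatrix_mult_vec_pick[OF MM Sc_sub Sc_sub c' ci] in auto)
      then show ?thesis by (simp add: G_def sum_divide_distrib sum_distrib_left mult.assoc)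
    qed
    have c\<Theta>2: "c \<bullet> (\<Theta>2 *\<^sub>v c) = (\<Sum>i\<in>Sc. \<Sum>j\<in>Sc. x i * \<theta> i j * x j)"
    proof -
      have rp: "rank (pick Sc i) = i" if "i < d - \<sigma>" for i
        unfolding rank_def using that cSc by (simp add: card_pick_le)
      have "c \<bullet> (\<Theta>2 *\<^sub>v c) = (\<Sum>i<card Sc. \<Sum>j<card Sc. x (pick Sc i) * \<theta> (pick Sc i) (pick Sc j) * x (pick Sc j))"
        unfolding quad_form_sum[OF \<Theta>2 c c] cSc
        by (intro sum.cong refl) (simp add: \<theta>_def rp ci cSc)
      then show ?thesis
        unfolding sum_pick[OF fSc, of "\<lambda>j. x _ * \<theta> _ j * x j"]
          sum_pick[OF fSc, of "\<lambda>i. \<Sum>j\<in>Sc. x i * \<theta> i j * x j"] .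
    qed
    have "c \<bullet> (\<Theta>1 *\<^sub>v c) + c \<bullet> (\<Theta>2 *\<^sub>v c) = c \<bullet> (Theta_mat n d \<sigma> S M \<epsilon> yS zS Y11 \<delta> \<mu>2 *\<^sub>v c)"
      unfolding \<Theta> using \<Theta>1 \<Theta>2 c
      by (simp add: add_mult_distrib_mat_vec[of _ "d - \<sigma>" "d - \<sigma>"] scalar_prod_add_distrib[of _ "d - \<sigma>"])
    also have "\<dots> = C.schur x"
      unfolding Theta_mat_form[OF M eps S_sub cS yS zS c Sc_def g_def[unfolded MM_def] u_def[unfolded me_def] h_def]
      unfolding MM_def[symmetric] cGc cc H0_mat_form[OF zS h h] zh hh zg u
      by (simp add: C.schur_def T_eq cS power2_eq_square)
    finally show ?thesis
      unfolding C.schur_gap_def T_eq c_def[symmetric] c\<Theta>2[symmetric] by simp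
  qed
  have gap_nonneg: "0 \<le> C.schur_gap x" for x unfolding gap by (rule nonneg1) simp
  \<comment> \<open>A positive definite \<Theta>1 yields the first disjunct; a strict norm bound on
    \<Theta>2, read on the diagonal, yields the second.\<close>
  have strict: "(\<forall>x. C.schur_gap x = 0 \<longrightarrow> (\<forall>i\<in>{..<d} - S. x i = 0)) \<or> (\<forall>i\<in>{..<d} - S. \<bar>\<theta> i i\<bar> < \<mu>3)"
    using cases
  proof
    assume pd: "pos_def (d - \<sigma>) \<Theta>1 \<and> mat_norm_inf \<Theta>2 \<le> mu3_star n \<sigma> S M \<epsilon> z \<delta>"
    have "x i = 0" if x: "C.schur_gap x = 0" and i: "i \<in> Sc" for x i
    proof -
      have "vec (d - \<sigma>) (\<lambda>i. x (pick Sc i)) = 0\<^sub>v (d - \<sigma>)"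
        using pd x unfolding gap pos_def_def by (metis less_irrefl vec_carrier)
      then have "vec (d - \<sigma>) (\<lambda>i. x (pick Sc i)) $ rank i = 0" using rank[OF i] by simp
      then show ?thesis using rank[OF i] pick_card_in_set[OF i] by (simp add: rank_def)
    qed
    then show ?thesis unfolding T_eq by blast
  next
    assume "pos_semidef (d - \<sigma>) \<Theta>1 \<and> mat_norm_inf \<Theta>2 < mu3_star n \<sigma> S M \<epsilon> z \<delta>"
    then show ?thesis unfolding T_eq using \<theta>_le by (fastforce simp: \<mu>3_def)
  qed
  let ?Z = "outer_prod (vCons 1 z) (vCons 1 z)"
  have Z: "?Z \<in> carrier_mat (Suc d) (Suc d)" using z by simp
  have Z_index: "?Z $$ (a, c) = C.w a * C.w c" if "a \<le> d" "c \<le> d" for a c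
    using that z by (cases a; cases c) (simp_all add: outer_prod_def)
  have feas: "sils_feasible d \<sigma> W \<longleftrightarrow> W \<in> carrier_mat (Suc d) (Suc d) \<and> C.feas (\<lambda>a c. W $$ (a, c))" for W
    unfolding sils_feasible_iff C.feas_def cS by simp
  have objective: "sils_objective n M b W = (b \<bullet> b) / real n + C.obj (\<lambda>a c. W $$ (a, c))"
    if "sils_feasible d \<sigma> W" for W
  proof -
    have yi: "- ((transpose_mat M *\<^sub>v b) $ i / real n) = y $ i" if "i < d" for i
      using that M b by (simp add: y_def)
    show ?thesis
      using that unfolding C.obj_def sils_feasible_iff
      by (subst sils_objective_eq[OF M b]) (auto simp: yi G_def MM_def)
  qed
  have Zfeas: "sils_feasible d \<sigma> ?Z"
    using Z C.feas_w unfolding feas C.feas_def by (simp add: Z_index)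
  have Zobj: "C.obj (\<lambda>a c. ?Z $$ (a, c)) = C.obj (\<lambda>a c. C.w a * C.w c)"
    unfolding C.obj_def by (simp add: Z_index)
  have "sils_optimal n d \<sigma> M b W \<longleftrightarrow> W = ?Z" for W
  proof
    assume W: "sils_optimal n d \<sigma> M b W"
    then have Wf: "sils_feasible d \<sigma> W" by (simp add: sils_optimal_def)
    have "C.obj (\<lambda>a c. W $$ (a, c)) \<le> C.obj (\<lambda>a c. C.w a * C.w c)"
      using W Zfeas objective[OF Wf] objective[OF Zfeas] Zobj by (auto simp: sils_optimal_def)
    then have "W $$ (a, c) = C.w a * C.w c" if "a \<le> d" "c \<le> d" for a c
      using C.obj_minimizer_unique[OF gap_nonneg _ _ strict that] Wf feas by auto
    then show "W = ?Z"
      using Wf Z Z_index unfolding feas by (intro eq_matI) (auto simp: less_Suc_eq_le)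
  next
    assume "W = ?Z"
    then show "sils_optimal n d \<sigma> M b W"
      using Zfeas C.obj_minimal[OF gap_nonneg] unfolding sils_optimal_def
      by (auto simp: objective Zobj feas)
  qed
  then show ?thesis using \<open>z \<in> sign_vecs d\<close> by (auto simp: sils_recovers_def)
qed

end
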